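(* Let $C$ be a clutter with finite vertex set $X$, let $\Bbbk$ be a field, and let $W$ be a minimal vertex cover of $C$. (1) For every $s\in\mathbb{N}$, the set $\mathcal{J}_s(W)$ is a minimal vertex cover of $\mathcal{J}_s(C)$. Equivalently, for every $s\in\mathbb{N}$, the ideal $\langle\mathcal{J}_s(W)\rangle$ of $\Bbbk[\mathcal{J}_s(X)]$ is a minimal prime of $\mathcal{J}_s(I(C))$. (2) For every $s\in\mathbb{N}$, the ideal $\langle\mathcal{J}_s(W)\rangle$ of $\Bbbk[\mathcal{J}_s(X)]$ is a primary component of $\mathcal{J}_s(I(C))$ (that is, the primary component of $\mathcal{J}_s(I(C))$ corresponding to the minimal prime $\langle\mathcal{J}_s(W)\rangle$ is $\langle\mathcal{J}_s(W)\rangle$ itself).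
   Context: $\mathbb{N}$ includes $0$. A clutter $C$ with vertex set $X$ is a family $E(C)$ of subsets of $X$ (edges), none of which is contained in another. $\Bbbk[X]$ is the polynomial ring with the elements of $X$ as variables; the edge ideal $I(C)\subseteq\Bbbk[X]$ is generated by the monomials $x_1\cdots x_r$ with $\{x_1,\dots,x_r\}\in E(C)$. This gives a bijection between clutters on $X$ and squarefree monomial ideals of $\Bbbk[X]$. A vertex cover of a clutter is a set of vertices meeting every edge; it is minimal if no proper subset is a vertex cover. For a set $Y$ and $s\in\mathbb{N}$ let $\mathcal{J}_s(Y)=\bigcup_{y\in Y}\{y_0,\dots,y_s\}$ (new distinct variables), and let $\phi_s\colon\Bbbk[X]\to\Bbbk[\mathcal{J}_s(X)][t]/\langle t^{s+1}\rangle$ be the $\Bbbk$-algebra homomorphism with $\phi_s(x)=\sum_{j=0}^s x_jt^j$. For an ideal $I=\langle f_1,\dots,f_r\rangle$ of $\Bbbk[X]$, the ideal of $s$-jets $\mathcal{J}_s(I)\subseteq\Bbbk[\mathcal{J}_s(X)]$ is generated by the $f_{i,j}$ ($1\le i\le r$, $0\le j\le s$) determined by $\phi_s(f_i)=\sum_{j=0}^s f_{i,j}t^j$. By a known theorem of Goward and Smith, if $I$ is a squarefree monomial ideal, then $\sqrt{\mathcal{J}_s(I)}$ is the squarefree monomial ideal minimally generated by the monomials $x_{1,i_1}\cdots x_{r,i_r}$ such that $x_1\cdots x_r$ is a minimal generator of $I$ and $i_1+\dots+i_r\le s$. The clutter of $s$-jets $\mathcal{J}_s(C)$ is the clutter with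 vertex set $\mathcal{J}_s(X)$ whose edge ideal is $\sqrt{\mathcal{J}_s(I(C))}$. *)

theory Defs
  imports
    "HOL-Library.Poly_Mapping"
    "HOL-Computational_Algebra.Polynomial"
    "HOL-Algebra.Ideal"
begin

section \<open>Polynomial rings in a set of variables\<close>

text \<open>
  A polynomial over \<open>'k\<close> in variables from \<open>'v\<close> is a finitely supported map from monomials to
  coefficients, a monomial being a finitely supported map from variables to exponents; the
  multiplication of \<^theory>\<open>HOL-Library.Poly_Mapping\<close> is the convolution product. For
  \<open>X :: 'v set\<close>, the ring \<open>'k[X]\<close> consists of the polynomials in which only variables
  from \<open>X\<close> occur. It is a record of \<^theory>\<open>HOL-Algebra.Ring\<close>, so that ideals and prime ideals are
  those of HOL-Algebra.
\<close>

type_synonym ('v, 'k) mpol = "('v \<Rightarrow>\<^sub>0 nat) \<Rightarrow>\<^sub>0 'k"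

definition mvars :: "('v, 'k::zero) mpol \<Rightarrow> 'v set" where
  "mvars p = (\<Union>m\<in>Poly_Mapping.keys p. Poly_Mapping.keys m)"

definition mvar :: "'v \<Rightarrow> ('v, 'k::comm_ring_1) mpol" where
  "mvar x = Poly_Mapping.single (Poly_Mapping.single x 1) 1"

definition mconst :: "'k \<Rightarrow> ('v, 'k::comm_ring_1) mpol" where
  "mconst c = Poly_Mapping.single 0 c"

definition mpoly_ring :: "'v set \<Rightarrow> ('v, 'k::comm_ring_1) mpol ring" where
  "mpoly_ring X = \<lparr>carrier = {p. mvars p \<subseteq> X}, mult = (*), one = 1, zero = 0, add = (+)\<rparr>"

definition var_ideal :: "'v set \<Rightarrow> 'v set \<Rightarrow> ('v, 'k::comm_ring_1) mpol set" where
  "var_ideal X Y = Idl\<^bsub>mpoly_ring X\<^esub> (mvar ` Y)"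


section \<open>Radicals, minimal primes, primary decompositions\<close>

definition radical :: "('a, 'm) ring_scheme \<Rightarrow> 'a set \<Rightarrow> 'a set" where
  "radical R I = {a \<in> carrier R. \<exists>n::nat. a [^]\<^bsub>R\<^esub> n \<in> I}"

definition minimal_prime :: "('a, 'm) ring_scheme \<Rightarrow> 'a set \<Rightarrow> 'a set \<Rightarrow> bool" where
  "minimal_prime R I P \<longleftrightarrow> primeideal P R \<and> I \<subseteq> P \<and>
     (\<forall>Q. primeideal Q R \<longrightarrow> I \<subseteq> Q \<longrightarrow> Q \<subseteq> P \<longrightarrow> Q = P)"

definition primary_ideal :: "('a, 'm) ring_scheme \<Rightarrow> 'a set \<Rightarrow> bool" where
  "primary_ideal R Q \<longleftrightarrow> ideal Q R \<and> Q \<noteq> carrier R \<and>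
     (\<forall>a\<in>carrier R. \<forall>b\<in>carrier R. a \<otimes>\<^bsub>R\<^esub> b \<in> Q \<longrightarrow> a \<in> Q \<or> b \<in> radical R Q)"

text \<open>
  A minimal (irredundant) primary decomposition: no component can be omitted and the radicals are
  pairwise distinct. Intersecting with the carrier makes the empty intersection the unit ideal.
\<close>

definition min_primary_decomposition ::
    "('a, 'm) ring_scheme \<Rightarrow> 'a set \<Rightarrow> 'a set set \<Rightarrow> bool" where
  "min_primary_decomposition R I S \<longleftrightarrow> finite S \<and> (\<forall>Q\<in>S. primary_ideal R Q) \<and>
     carrier R \<inter> \<Inter>S = I \<and> inj_on (radical R) S \<and>
     (\<forall>Q\<in>S. carrier R \<inter> \<Inter>(S - {Q}) \<noteq> I)"

definition primary_component :: "('a, 'm) ring_scheme \<Rightarrow> 'a set \<Rightarrow> 'a set \<Rightarrow> bool" where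
  "primary_component R I Q \<longleftrightarrow> (\<exists>S. min_primary_decomposition R I S \<and> Q \<in> S)"


section \<open>Clutters\<close>

text \<open>A clutter is given by its vertex set \<open>X\<close> and its set \<open>E\<close> of edges.\<close>

definition clutter :: "'v set \<Rightarrow> 'v set set \<Rightarrow> bool" where
  "clutter X E \<longleftrightarrow> E \<subseteq> Pow X \<and> (\<forall>A\<in>E. \<forall>B\<in>E. A \<subseteq> B \<longrightarrow> A = B)"

definition edge_ideal :: "'v set \<Rightarrow> 'v set set \<Rightarrow> ('v, 'k::comm_ring_1) mpol set" where
  "edge_ideal X E = Idl\<^bsub>mpoly_ring X\<^esub> ((\<lambda>e. \<Prod>x\<in>e. mvar x) ` E)"

definition vertex_cover :: "'v set \<Rightarrow> 'v set set \<Rightarrow> 'v set \<Rightarrow> bool" where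
  "vertex_cover X E W \<longleftrightarrow> W \<subseteq> X \<and> (\<forall>e\<in>E. W \<inter> e \<noteq> {})"

definition minimal_vertex_cover :: "'v set \<Rightarrow> 'v set set \<Rightarrow> 'v set \<Rightarrow> bool" where
  "minimal_vertex_cover X E W \<longleftrightarrow> vertex_cover X E W \<and> (\<forall>V. V \<subset> W \<longrightarrow> \<not> vertex_cover X E V)"


section \<open>Jets\<close>

text \<open>The pair \<open>(y, j)\<close> is the jet variable \<open>y\<^sub>j\<close>.\<close>

definition jet_vars :: "nat \<Rightarrow> 'v set \<Rightarrow> ('v \<times> nat) set" where
  "jet_vars s Y = Y \<times> {0..s}"

text \<open>
  The substitution \<open>x \<mapsto> x\<^sub>0 + x\<^sub>1 t + \<dots> + x\<^sub>s t\<^sup>s\<close> as a map to polynomials in \<open>t\<close>.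
  The homomorphism to the truncated ring, in which \<open>t\<^sup>s\<^sup>+\<^sup>1 = 0\<close>, is this map followed by the
  quotient map, so the coefficients that it determines are those of \<open>t\<^sup>j\<close> for \<open>j \<le> s\<close>; see
  \<open>jet_subst_truncated\<close> below.
\<close>

definition jet_subst_monom :: "nat \<Rightarrow> ('v \<Rightarrow>\<^sub>0 nat) \<Rightarrow> ('v \<times> nat, 'k::comm_ring_1) mpol poly" where
  "jet_subst_monom s m =
     (\<Prod>x\<in>Poly_Mapping.keys m. (\<Sum>j\<le>s. monom (mvar (x, j)) j) ^ Poly_Mapping.lookup m x)"

definition jet_subst :: "nat \<Rightarrow> ('v, 'k::comm_ring_1) mpol \<Rightarrow> ('v \<times> nat, 'k) mpol poly" where
  "jet_subst s f = (\<Sum>m\<in>Poly_Mapping.keys f. smult (mconst (Poly_Mapping.lookup f m)) (jet_subst_monom s m))"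

definition jet_gens :: "nat \<Rightarrow> ('v, 'k::comm_ring_1) mpol set \<Rightarrow> ('v \<times> nat, 'k) mpol set" where
  "jet_gens s F = {coeff (jet_subst s f) j | f j. f \<in> F \<and> j \<le> s}"

text \<open>
  The ideal of \<open>s\<close>-jets does not depend on the chosen finite generating set \<open>F\<close> of \<open>I\<close>; this is
  \<open>jet_ideal_genideal\<close> below.
\<close>

definition jet_ideal ::
    "'v set \<Rightarrow> nat \<Rightarrow> ('v, 'k::comm_ring_1) mpol set \<Rightarrow> ('v \<times> nat, 'k) mpol set" where
  "jet_ideal X s I = (THE J. \<exists>F. finite F \<and> F \<subseteq> carrier (mpoly_ring X) \<and>
     I = Idl\<^bsub>mpoly_ring X\<^esub> F \<and> J = Idl\<^bsub>mpoly_ring (jet_vars s X)\<^esub> (jet_gens s F))"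

text \<open>
  The edge set of the clutter of \<open>s\<close>-jets; its vertex set is \<open>jet_vars s X\<close>. By the theorem of
  Goward and Smith the radical below is a squarefree monomial ideal when \<open>'k\<close> is a field, so it is
  the edge ideal of a unique clutter. The first argument only fixes the coefficients \<open>'k\<close>.
\<close>

definition jet_clutter ::
    "'k::comm_ring_1 itself \<Rightarrow> 'v set \<Rightarrow> nat \<Rightarrow> 'v set set \<Rightarrow> ('v \<times> nat) set set" where
  "jet_clutter _ X s E = (THE E'. clutter (jet_vars s X) E' \<and>
     (edge_ideal (jet_vars s X) E' :: ('v \<times> nat, 'k) mpol set) =
       radical (mpoly_ring (jet_vars s X)) (jet_ideal X s (edge_ideal X E)))"


section \<open>Basic facts on the definitions\<close>

lemma mvars_simps [simp]:
  "mvars (0 :: ('v, 'k::comm_ring_1) mpol) = {}"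
  "mvars (1 :: ('v, 'k::comm_ring_1) mpol) = {}"
  "mvars (mconst c :: ('v, 'k::comm_ring_1) mpol) = {}"
  "mvars (mvar x :: ('v, 'k::comm_ring_1) mpol) = {x}"
  by (auto simp: mvars_def mconst_def mvar_def)

lemma mvars_uminus [simp]: "mvars (- p :: ('v, 'k::comm_ring_1) mpol) = mvars p"
  by (auto simp: mvars_def in_keys_iff)

lemma mvars_add: "mvars (p + q :: ('v, 'k::comm_ring_1) mpol) \<subseteq> mvars p \<union> mvars q"
  using keys_add[of p q] by (auto simp: mvars_def)

lemma mvars_mult: "mvars (p * q :: ('v, 'k::comm_ring_1) mpol) \<subseteq> mvars p \<union> mvars q"
proof
  fix x assume "x \<in> mvars (p * q)"
  then obtain m where m: "m \<in> Poly_Mapping.keys (p * q)" "x \<in> Poly_Mapping.keys m"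
    by (auto simp: mvars_def)
  then obtain a b where "a \<in> Poly_Mapping.keys p" "b \<in> Poly_Mapping.keys q" "m = a + b"
    using keys_mult[of p q] by blast
  then show "x \<in> mvars p \<union> mvars q"
    using m(2) keys_add[of a b] by (auto simp: mvars_def)
qed

lemma mpoly_ring_simps [simp]:
  "p \<in> carrier (mpoly_ring X) \<longleftrightarrow> mvars p \<subseteq> X"
  "mult (mpoly_ring X) = (*)" "one (mpoly_ring X) = 1"
  "zero (mpoly_ring X) = 0" "add (mpoly_ring X) = (+)"
  by (simp_all add: mpoly_ring_def)

lemma mvars_add_le: "mvars p \<subseteq> X \<Longrightarrow> mvars q \<subseteq> X \<Longrightarrow> mvars (p + q :: ('v, 'k::comm_ring_1) mpol) \<subseteq> X"
  using mvars_add[of p q] by blast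

lemma mvars_mult_le: "mvars p \<subseteq> X \<Longrightarrow> mvars q \<subseteq> X \<Longrightarrow> mvars (p * q :: ('v, 'k::comm_ring_1) mpol) \<subseteq> X"
  using mvars_mult[of p q] by blast

lemma cring_mpoly_ring: "cring (mpoly_ring X :: ('v, 'k::comm_ring_1) mpol ring)"
proof (rule cringI)
  show "abelian_group (mpoly_ring X :: ('v, 'k) mpol ring)"
  proof (rule abelian_groupI; (simp add: mvars_add_le algebra_simps; fail)?)
    fix p :: "('v, 'k) mpol" assume "p \<in> carrier (mpoly_ring X)"
    then show "\<exists>q\<in>carrier (mpoly_ring X). q \<oplus>\<^bsub>mpoly_ring X\<^esub> p = \<zero>\<^bsub>mpoly_ring X\<^esub>"
      by (intro bexI[of _ "- p"]) auto
  qed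
  show "comm_monoid (mpoly_ring X :: ('v, 'k) mpol ring)"
    by (rule comm_monoidI) (simp_all add: mvars_mult_le algebra_simps)
qed (simp add: algebra_simps)

lemma mpol_expand:
  "(\<Sum>m\<in>Poly_Mapping.keys f. Poly_Mapping.single m (Poly_Mapping.lookup f m)) = (f :: 'a \<Rightarrow>\<^sub>0 'b::comm_monoid_add)"
proof (rule poly_mapping_eqI)
  fix k
  have "Poly_Mapping.lookup (\<Sum>m\<in>Poly_Mapping.keys f. Poly_Mapping.single m (Poly_Mapping.lookup f m)) k =
        (\<Sum>m\<in>Poly_Mapping.keys f. if m = k then Poly_Mapping.lookup f m else 0)"
    by (simp add: lookup_sum lookup_single when_def)
  also have "\<dots> = Poly_Mapping.lookup f k"
    by (simp add: in_keys_iff)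
  finally show "Poly_Mapping.lookup (\<Sum>m\<in>Poly_Mapping.keys f. Poly_Mapping.single m (Poly_Mapping.lookup f m)) k = Poly_Mapping.lookup f k" .
qed

lemma jet_subst_superset:
  assumes "finite A" "Poly_Mapping.keys f \<subseteq> A"
  shows "jet_subst s f = (\<Sum>m\<in>A. smult (mconst (Poly_Mapping.lookup f m)) (jet_subst_monom s m))"
  unfolding jet_subst_def using assms
  by (intro sum.mono_neutral_left) (auto simp: in_keys_iff mconst_def)

lemma jet_subst_monom_superset:
  assumes "finite A" "Poly_Mapping.keys m \<subseteq> A"
  shows "jet_subst_monom s m = (\<Prod>x\<in>A. (\<Sum>j\<le>s. monom (mvar (x, j)) j) ^ Poly_Mapping.lookup m x)"
  unfolding jet_subst_monom_def using assms
  by (intro prod.mono_neutral_left) (auto simp: in_keys_iff)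

lemma jet_subst_zero [simp]: "jet_subst s 0 = 0"
  by (simp add: jet_subst_def)

lemma mconst_add: "mconst (a + b) = mconst a + mconst b"
  by (simp add: mconst_def single_add)

lemma mconst_mult: "mconst (a * b) = mconst a * mconst b"
  by (simp add: mconst_def mult_single)

lemma jet_subst_add: "jet_subst s (f + g) = jet_subst s f + jet_subst s g"
proof -
  let ?A = "Poly_Mapping.keys f \<union> Poly_Mapping.keys g"
  have "jet_subst s (f + g) = (\<Sum>m\<in>?A. smult (mconst (Poly_Mapping.lookup (f + g) m)) (jet_subst_monom s m))"
    by (rule jet_subst_superset) (auto dest: subsetD[OF keys_add])
  also have "\<dots> = jet_subst s f + jet_subst s g"
    by (simp add: lookup_add mconst_add smult_add_left sum.distrib
        jet_subst_superset[of ?A f] jet_subst_superset[of ?A g])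
  finally show ?thesis .
qed

lemma jet_subst_sum: "jet_subst s (\<Sum>i\<in>A. f i) = (\<Sum>i\<in>A. jet_subst s (f i))"
  by (induction A rule: infinite_finite_induct) (simp_all add: jet_subst_add)

lemma jet_subst_single:
  "jet_subst s (Poly_Mapping.single m c) = smult (mconst c) (jet_subst_monom s m)"
  by (subst jet_subst_superset[of "{m}"]) auto

lemma jet_subst_monom_add: "jet_subst_monom s (m + n) = jet_subst_monom s m * jet_subst_monom s n"
proof -
  let ?A = "Poly_Mapping.keys m \<union> Poly_Mapping.keys n"
  have "jet_subst_monom s (m + n) = (\<Prod>x\<in>?A. (\<Sum>j\<le>s. monom (mvar (x, j)) j) ^ Poly_Mapping.lookup (m + n) x)"
    by (rule jet_subst_monom_superset) (auto dest: subsetD[OF keys_add])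
  also have "\<dots> = jet_subst_monom s m * jet_subst_monom s n"
    by (simp add: lookup_add power_add prod.distrib
        jet_subst_monom_superset[of ?A m] jet_subst_monom_superset[of ?A n])
  finally show ?thesis .
qed

lemma jet_subst_mult: "jet_subst s (f * g) = jet_subst s f * jet_subst s g"
proof -
  have "jet_subst s (f * g) =
      jet_subst s ((\<Sum>m\<in>Poly_Mapping.keys f. Poly_Mapping.single m (Poly_Mapping.lookup f m)) *
                   (\<Sum>n\<in>Poly_Mapping.keys g. Poly_Mapping.single n (Poly_Mapping.lookup g n)))"
    by (simp only: mpol_expand)
  also have "\<dots> = (\<Sum>m\<in>Poly_Mapping.keys f. \<Sum>n\<in>Poly_Mapping.keys g.
      smult (mconst (Poly_Mapping.lookup f m)) (jet_subst_monom s m) *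
      smult (mconst (Poly_Mapping.lookup g n)) (jet_subst_monom s n))"
    by (simp add: sum_product mult_single jet_subst_sum jet_subst_single jet_subst_monom_add
        mconst_mult mult.commute mult.left_commute)
  also have "\<dots> = jet_subst s f * jet_subst s g"
    by (simp add: jet_subst_def sum_product)
  finally show ?thesis .
qed

lemma jet_subst_const: "jet_subst s (mconst c) = [:mconst c:]"
  unfolding mconst_def[of c, where 'v = 'a] jet_subst_single by (simp add: jet_subst_monom_def)

lemma jet_subst_one: "jet_subst s 1 = 1"
  using jet_subst_const[of s 1] by (simp add: mconst_def one_pCons)

lemma jet_subst_var: "jet_subst s (mvar x) = (\<Sum>j\<le>s. monom (mvar (x, j)) j)"
  unfolding mvar_def[of x] jet_subst_single by (simp add: jet_subst_monom_def mconst_def)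

lemma jet_subst_truncated:
  "monom 1 (Suc s) dvd jet_subst s f - (\<Sum>j\<le>s. monom (c j) j) \<longleftrightarrow>
     (\<forall>j\<le>s. c j = coeff (jet_subst s f) j)"
proof -
  have "coeff (\<Sum>j\<le>s. monom (c j) j) n = (if n \<le> s then c n else 0)" for n
    by (simp add: coeff_sum)
  then show ?thesis
    by (auto simp: monom_1_dvd_iff' less_Suc_eq_le)
qed

lemma coeff_in_carrier_mult:
  fixes p q :: "('v, 'k::comm_ring_1) mpol poly"
  assumes "\<And>i. mvars (coeff p i) \<subseteq> Y" "\<And>i. mvars (coeff q i) \<subseteq> Y"
  shows "mvars (coeff (p * q) i) \<subseteq> Y"
proof -
  have *: "mvars (\<Sum>a\<in>A. h a) \<subseteq> Y" if "\<And>a. mvars (h a) \<subseteq> Y" for A and h :: "nat \<Rightarrow> ('v, 'k) mpol"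
    using that by (induction A rule: infinite_finite_induct) (simp_all add: mvars_add_le)
  show ?thesis
    unfolding coeff_mult by (rule *) (intro mvars_mult_le assms)
qed

lemma mvars_coeff_jet_subst:
  fixes f :: "('v, 'k::comm_ring_1) mpol"
  assumes "mvars f \<subseteq> X"
  shows "mvars (coeff (jet_subst s f) i) \<subseteq> jet_vars s X"
proof -
  let ?C = "{p :: ('v \<times> nat, 'k) mpol poly. \<forall>i. mvars (coeff p i) \<subseteq> jet_vars s X}"
  have mult: "p * q \<in> ?C" if "p \<in> ?C" "q \<in> ?C" for p q
    using that by (simp add: coeff_in_carrier_mult)
  have add: "p + q \<in> ?C" if "p \<in> ?C" "q \<in> ?C" for p q
    using that by (simp add: mvars_add_le)
  have one: "1 \<in> ?C" and zero: "0 \<in> ?C"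
    by (auto simp: coeff_1)
  have pow: "p ^ n \<in> ?C" if "p \<in> ?C" for p n
    using that by (induction n) (use one mult in auto)
  have sum: "(\<Sum>a\<in>A. h a) \<in> ?C" if "\<And>a. a \<in> A \<Longrightarrow> h a \<in> ?C" for A and h :: "'b \<Rightarrow> _"
    using that by (induction A rule: infinite_finite_induct) (use zero add in auto)
  have prod: "(\<Prod>a\<in>A. h a) \<in> ?C" if "\<And>a. a \<in> A \<Longrightarrow> h a \<in> ?C" for A and h :: "'b \<Rightarrow> _"
    using that by (induction A rule: infinite_finite_induct) (use one mult in auto)
  have mon: "monom (mvar (x, j)) j \<in> ?C" if "x \<in> X" "j \<le> s" for x j
    using that by (auto simp: jet_vars_def split: if_splits)
  have M: "jet_subst_monom s m \<in> ?C" if "Poly_Mapping.keys m \<subseteq> X" for m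
    unfolding jet_subst_monom_def using that by (intro prod pow sum mon) auto
  have smult: "smult (mconst c) p \<in> ?C" if "p \<in> ?C" for c p
    using that by (simp add: mvars_mult_le)
  have "jet_subst s f \<in> ?C"
    unfolding jet_subst_def using assms
    by (intro sum smult M) (auto simp: mvars_def)
  then show ?thesis by simp
qed

lemma jet_gens_subset_iff:
  assumes F: "F \<subseteq> carrier (mpoly_ring X)"
    and K: "ideal K (mpoly_ring (jet_vars s X) :: ('v \<times> nat, 'k::comm_ring_1) mpol ring)"
  shows "jet_gens s (Idl\<^bsub>mpoly_ring X\<^esub> F) \<subseteq> K \<longleftrightarrow> jet_gens s F \<subseteq> K"
proof
  let ?R = "mpoly_ring X :: ('v, 'k) mpol ring"
  interpret R: cring ?R by (rule cring_mpoly_ring)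
  interpret K: ideal K "mpoly_ring (jet_vars s X)" by (rule K)
  show "jet_gens s F \<subseteq> K" if "jet_gens s (Idl\<^bsub>?R\<^esub> F) \<subseteq> K"
    using that R.genideal_self[OF F] by (auto simp: jet_gens_def)
  assume gens: "jet_gens s F \<subseteq> K"
  have Kadd: "a + b \<in> K" if "a \<in> K" "b \<in> K" for a b
    using additive_subgroup.a_closed[OF K.is_additive_subgroup that] by simp
  have Kmult: "a * b \<in> K" if "b \<in> K" "mvars a \<subseteq> jet_vars s X" for a b
    using K.I_l_closed[of b a] that by simp
  have K0: "0 \<in> K" using additive_subgroup.zero_closed[OF K.is_additive_subgroup] by simp
  have Ksum: "(\<Sum>a\<in>A. h a) \<in> K" if "\<And>a. a \<in> A \<Longrightarrow> h a \<in> K" for A and h :: "nat \<Rightarrow> _"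
    using that by (induction A rule: infinite_finite_induct) (use K0 Kadd in auto)
  let ?A = "{f \<in> carrier ?R. \<forall>j\<le>s. coeff (jet_subst s f) j \<in> K}"
  have absorb: "g * f \<in> ?A" if "f \<in> ?A" "mvars g \<subseteq> X" for f g
    using that by (simp add: jet_subst_mult coeff_mult mvars_mult_le Ksum Kmult
        mvars_coeff_jet_subst)
  have Aadd: "f + g \<in> ?A" if "f \<in> ?A" "g \<in> ?A" for f g
    using that by (auto simp: jet_subst_add intro!: Kadd dest!: subsetD[OF mvars_add])
  have "ideal ?A ?R"
  proof (rule idealI)
    show "ring ?R" by (rule R.ring_axioms)
    show "subgroup ?A (add_monoid ?R)"
    proof (rule R.add.subgroupI)
      have "(0 :: ('v, 'k) mpol) \<in> ?A" using K0 by simp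
      then show "?A \<noteq> {}" by blast
      fix f assume f: "f \<in> ?A"
      then have "mvars f \<subseteq> X" by simp
      then have "\<ominus>\<^bsub>?R\<^esub> f = - f" by (intro R.minus_equality) auto
      also have "\<dots> \<in> ?A" using absorb[OF f, of "- 1"] by simp
      finally show "\<ominus>\<^bsub>?R\<^esub> f \<in> ?A" .
    qed (use Aadd in auto)
  next
    fix f g assume "f \<in> ?A" "g \<in> carrier ?R"
    then show "g \<otimes>\<^bsub>?R\<^esub> f \<in> ?A" "f \<otimes>\<^bsub>?R\<^esub> g \<in> ?A"
      using absorb[of f g] by (simp_all add: mult.commute)
  qed
  moreover have "F \<subseteq> ?A"
    using F gens unfolding jet_gens_def by blast
  ultimately have "Idl\<^bsub>?R\<^esub> F \<subseteq> ?A" by (rule R.genideal_minimal)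
  then show "jet_gens s (Idl\<^bsub>?R\<^esub> F) \<subseteq> K" by (auto simp: jet_gens_def)
qed

lemma jet_ideal_genideal:
  fixes F :: "('v, 'k::comm_ring_1) mpol set"
  assumes "finite F" "F \<subseteq> carrier (mpoly_ring X)"
  shows "jet_ideal X s (Idl\<^bsub>mpoly_ring X\<^esub> F) = Idl\<^bsub>mpoly_ring (jet_vars s X)\<^esub> (jet_gens s F)"
proof -
  have eq: "Idl\<^bsub>mpoly_ring (jet_vars s X)\<^esub> (jet_gens s G) =
      Idl\<^bsub>mpoly_ring (jet_vars s X)\<^esub> (jet_gens s (Idl\<^bsub>mpoly_ring X\<^esub> G))"
    if "G \<subseteq> carrier (mpoly_ring X)" for G :: "('v, 'k) mpol set"
    unfolding genideal_def[of "mpoly_ring (jet_vars s X)"]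
    using jet_gens_subset_iff[OF that, of _ s] by (intro arg_cong[where f = Inter]) blast
  show ?thesis
    unfolding jet_ideal_def by (rule the_equality) (use assms eq in metis)+
qed

end

theory Submission
  imports Defs "HOL-Algebra.Ring_Divisibility"
begin

text \<open>
  Let \<open>J\<close> be the ideal of \<open>s\<close>-jets and \<open>P\<close> the prime generated by the jet variables of \<open>W\<close>. By minimality
  every \<open>x \<in> W\<close> lies on an edge that meets \<open>W\<close> in \<open>x\<close> only. Let \<open>c \<notin> P\<close> be the product of the
  variables \<open>y\<^sub>0\<close> of the other vertices \<open>y\<close> of this edge. Solving the jet equations of the edge one after
  the other gives \<open>c\<^sup>j\<^sup>+\<^sup>1 x\<^sub>j \<in> J\<close>, so \<open>J\<close> and \<open>P\<close> agree in the localization at \<open>P\<close>. Therefore \<open>P\<close> is a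
  minimal prime of \<open>J\<close> and its own primary component. The primary decomposition exists by Hilbert's
  basis theorem and the Lasker--Noether theorem. For the jet clutter, the radical of \<open>J\<close> is the
  intersection of the primes \<open>Q\<close> above it, and modulo such a \<open>Q\<close> the orders in \<open>t\<close> of the series
  substituted for the vertices of an edge add up to more than \<open>s\<close>; this is the theorem of Goward and
  Smith. A vertex cover inside the jets of \<open>W\<close> generates a prime between \<open>J\<close> and \<open>P\<close>.
\<close>

hide_const (open) up_ring.coeff up_ring.monom

section \<open>Noetherian rings\<close>

text \<open>In a noetherian ring the union of a nonempty chain of ideals is itself a member of the
  chain. Zorn's lemma therefore applies to arbitrary families, with no closure property to
  check.\<close>

lemma (in noetherian_ring) maximal_ideal_in_family:
  assumes "S \<noteq> {}" "\<And>I. I \<in> S \<Longrightarrow> ideal I R"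
  shows "\<exists>M\<in>S. \<forall>I\<in>S. M \<subseteq> I \<longrightarrow> I = M"
proof (rule subset_Zorn_nonempty[OF assms(1)])
  fix C assume "C \<noteq> {}" and C: "subset.chain S C"
  moreover have "subset.chain {I. ideal I R} C"
    using C assms(2) by (auto simp: pred_on.chain_def)
  ultimately have "\<Union>C \<in> C" by (intro ideal_chain_is_trivial)
  then show "\<Union>C \<in> S" using C by (auto simp: pred_on.chain_def)
qed

section \<open>Adjoining an element to an ideal; prime ideals avoiding powers; irreducible
  ideals\<close>

lemma (in cring) mem_add_PIdl:
  assumes "a \<in> carrier R"
  shows "x \<in> I <+>\<^bsub>R\<^esub> PIdl a \<longleftrightarrow> (\<exists>q\<in>I. \<exists>r\<in>carrier R. x = q \<oplus> r \<otimes> a)"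
  by (auto simp: set_add_def' cgenideal_def)

lemma (in cring) add_PIdl:
  assumes "ideal I R" "a \<in> carrier R"
  shows "ideal (I <+>\<^bsub>R\<^esub> PIdl a) R" "I \<subseteq> I <+>\<^bsub>R\<^esub> PIdl a" "a \<in> I <+>\<^bsub>R\<^esub> PIdl a"
proof -
  interpret I: ideal I R by fact
  show "ideal (I <+>\<^bsub>R\<^esub> PIdl a) R"
    by (intro add_ideals assms cgenideal_ideal)
  show "I \<subseteq> I <+>\<^bsub>R\<^esub> PIdl a"
  proof
    fix x assume "x \<in> I"
    then have "x = x \<oplus> \<zero> \<otimes> a" using I.Icarr assms(2) by simp
    then show "x \<in> I <+>\<^bsub>R\<^esub> PIdl a"
      unfolding mem_add_PIdl[OF assms(2)] using \<open>x \<in> I\<close> zero_closed by blast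
  qed
  have "a = \<zero> \<oplus> \<one> \<otimes> a" using assms(2) by simp
  then show "a \<in> I <+>\<^bsub>R\<^esub> PIdl a"
    unfolding mem_add_PIdl[OF assms(2)] using I.zero_closed one_closed by blast
qed

text \<open>An ideal maximal among those above \<open>J\<close> without powers of \<open>a\<close>
  is prime: adjoining \<open>x\<close> or \<open>y\<close> from outside brings in a power of
  \<open>a\<close>, and if \<open>x \<otimes> y\<close> were inside, so would be the product of
  these two powers.\<close>

lemma (in cring) prime_ideal_avoiding_powers:
  assumes noeth: "noetherian_ring R" and J: "ideal J R" and a: "a \<in> carrier R"
    and pow: "\<And>n::nat. a [^] n \<notin> J"
  obtains P where "primeideal P R" "J \<subseteq> P" "a \<notin> P"
proof -
  interpret N: noetherian_ring R by fact
  let ?S = "{I. ideal I R \<and> J \<subseteq> I \<and> (\<forall>n::nat. a [^] n \<notin> I)}"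
  have "\<exists>P\<in>?S. \<forall>I\<in>?S. P \<subseteq> I \<longrightarrow> I = P"
    by (rule N.maximal_ideal_in_family) (use J pow in auto)
  then obtain P where PS: "P \<in> ?S" and max': "\<forall>I\<in>?S. P \<subseteq> I \<longrightarrow> I = P"
    by (rule bexE)
  then have P: "ideal P R" "J \<subseteq> P" and aP: "\<And>n::nat. a [^] n \<notin> P"
    by simp_all
  have max: "I = P" if "I \<in> ?S" "P \<subseteq> I" for I
    using max' that by (metis (no_types, lifting))
  interpret P: ideal P R by fact
  have power_in: "\<exists>n::nat. a [^] n \<in> P <+>\<^bsub>R\<^esub> PIdl x" if "x \<in> carrier R" "x \<notin> P" for x
  proof (rule ccontr)
    assume "\<not> ?thesis"
    then have "P <+>\<^bsub>R\<^esub> PIdl x = P"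
      using add_PIdl[OF P(1) that(1)] P(2) by (intro max) auto
    then show False using add_PIdl(3)[OF P(1) that(1)] that(2) by simp
  qed
  have "primeideal P R"
  proof (rule primeidealI[OF P(1) is_cring])
    show "carrier R \<noteq> P" using aP[of 0] by auto
    fix x y assume x: "x \<in> carrier R" and y: "y \<in> carrier R" and xy: "x \<otimes> y \<in> P"
    show "x \<in> P \<or> y \<in> P"
    proof (rule ccontr)
      assume "\<not> (x \<in> P \<or> y \<in> P)"
      then obtain m n :: nat where "a [^] m \<in> P <+>\<^bsub>R\<^esub> PIdl x" "a [^] n \<in> P <+>\<^bsub>R\<^esub> PIdl y"
        using power_in x y by blast
      then obtain p q r s where pr: "p \<in> P" "r \<in> carrier R" "a [^] m = p \<oplus> r \<otimes> x"
        and qs: "q \<in> P" "s \<in> carrier R" "a [^] n = q \<oplus> s \<otimes> y"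
        unfolding mem_add_PIdl[OF x] mem_add_PIdl[OF y] by blast
      have pc: "p \<in> carrier R" "q \<in> carrier R" using pr qs P.Icarr by auto
      have "a [^] (m + n) = (p \<oplus> r \<otimes> x) \<otimes> (q \<oplus> s \<otimes> y)"
        using a pr qs by (simp add: nat_pow_mult[symmetric])
      also have "\<dots> = p \<otimes> (q \<oplus> s \<otimes> y) \<oplus> ((r \<otimes> x) \<otimes> q \<oplus> (r \<otimes> s) \<otimes> (x \<otimes> y))"
        using pc x y pr qs by algebra
      also have "\<dots> \<in> P"
        using pc x y pr qs xy
        by (intro P.a_closed P.I_r_closed[of p] P.I_l_closed[of q] P.I_l_closed[of "x \<otimes> y"]) auto
      finally show False using aP by simp
    qed
  qed
  then show ?thesis using that P(2) aP[of 1] a by simp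
qed

text \<open>Once the colon ideals \<open>K n\<close> of \<open>Q\<close> by the powers of
  \<open>b\<close> become stationary, \<open>Q\<close> is the intersection of the ideals obtained by
  adjoining \<open>b [^] n\<close> and \<open>a\<close>. Irreducibility then puts one of these two
  elements into \<open>Q\<close>.\<close>

lemma (in cring) irreducible_imp_primary:
  assumes noeth: "noetherian_ring R" and Q: "ideal Q R" "Q \<noteq> carrier R"
    and irr: "\<And>A B. ideal A R \<Longrightarrow> ideal B R \<Longrightarrow> Q = A \<inter> B \<Longrightarrow> Q = A \<or> Q = B"
  shows "primary_ideal R Q"
  unfolding primary_ideal_def
proof (intro conjI ballI impI Q)
  interpret N: noetherian_ring R by fact
  interpret Q: ideal Q R by fact
  fix a b assume a: "a \<in> carrier R" and b: "b \<in> carrier R" and ab: "a \<otimes> b \<in> Q"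
  show "a \<in> Q \<or> b \<in> radical R Q"
  proof (rule disjCI)
    assume bQ: "b \<notin> radical R Q"
    define K where "K n = {r \<in> carrier R. r \<otimes> b [^] n \<in> Q}" for n :: nat
    have K: "ideal (K n) R" for n
    proof (intro idealI ring_axioms add.subgroupI)
      show "K n \<noteq> {}" unfolding K_def using b Q.zero_closed by (auto intro!: exI[of _ \<zero>])
    qed (use b in \<open>auto simp: K_def l_distr l_minus m_assoc
          intro: Q.I_l_closed Q.a_closed Q.a_inv_closed\<close>,
        use b in \<open>metis Q.I_l_closed m_assoc m_comm nat_pow_closed\<close>)
    \<comment> \<open>The ascending chain condition is used only for a single coincidence
      \<open>K (Suc n) = K n\<close>.\<close>
    have "\<exists>M\<in>range K. \<forall>I\<in>range K. M \<subseteq> I \<longrightarrow> I = M"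
      by (rule N.maximal_ideal_in_family) (use K in auto)
    then obtain n where n: "\<forall>I\<in>range K. K n \<subseteq> I \<longrightarrow> I = K n" by auto
    have "K n \<subseteq> K (Suc n)"
      using b by (auto simp: K_def m_assoc[symmetric] intro: Q.I_r_closed)
    then have stable: "K (Suc n) = K n" using n by simp
    let ?c = "b [^] n"
    have c: "?c \<in> carrier R" using b by simp
    have "Q = (Q <+>\<^bsub>R\<^esub> PIdl ?c) \<inter> (Q <+>\<^bsub>R\<^esub> PIdl a)"
    proof
      show "Q \<subseteq> (Q <+>\<^bsub>R\<^esub> PIdl ?c) \<inter> (Q <+>\<^bsub>R\<^esub> PIdl a)"
        using add_PIdl(2)[OF Q(1) c] add_PIdl(2)[OF Q(1) a] by simp
      show "(Q <+>\<^bsub>R\<^esub> PIdl ?c) \<inter> (Q <+>\<^bsub>R\<^esub> PIdl a) \<subseteq> Q"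
      proof
        fix y assume "y \<in> (Q <+>\<^bsub>R\<^esub> PIdl ?c) \<inter> (Q <+>\<^bsub>R\<^esub> PIdl a)"
        then obtain p r q s where y1: "p \<in> Q" "r \<in> carrier R" "y = p \<oplus> r \<otimes> ?c"
          and y2: "q \<in> Q" "s \<in> carrier R" "y = q \<oplus> s \<otimes> a"
          using mem_add_PIdl[OF c] mem_add_PIdl[OF a] by (smt (verit) Int_iff)
        have pc: "p \<in> carrier R" "q \<in> carrier R" using y1 y2 Q.Icarr by auto
        \<comment> \<open>Multiplying the two expressions for \<open>y\<close> by \<open>b\<close>
          turns \<open>s \<otimes> a\<close> into an element of \<open>Q\<close>. Thus
          \<open>r\<close> lies in \<open>K (Suc n)\<close>, hence in \<open>K n\<close>, and
          \<open>y\<close> loses its part outside \<open>Q\<close>.\<close>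
        have "r \<otimes> b [^] Suc n = ((q \<oplus> s \<otimes> a) \<ominus> p) \<otimes> b"
        proof -
          have "r \<otimes> b [^] Suc n = ((p \<oplus> r \<otimes> ?c) \<ominus> p) \<otimes> b"
            using pc y1 c b unfolding nat_pow_Suc by algebra
          then show ?thesis using y1(3) y2(3) by simp
        qed
        also have "\<dots> = (q \<ominus> p) \<otimes> b \<oplus> s \<otimes> (a \<otimes> b)"
          using pc y2 a b by algebra
        also have "\<dots> \<in> Q"
          using y1 y2 b ab
          by (intro Q.a_closed Q.I_r_closed[of "q \<ominus> p"] Q.I_l_closed[of "a \<otimes> b"])
            (auto simp: a_minus_def)
        finally have "r \<in> K (Suc n)" using y1 by (simp add: K_def)
        then have "r \<in> K n" using stable by simp
        then have "r \<otimes> ?c \<in> Q" by (simp add: K_def)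
        then show "y \<in> Q" using y1 by simp
      qed
    qed
    then consider "Q = Q <+>\<^bsub>R\<^esub> PIdl ?c" | "Q = Q <+>\<^bsub>R\<^esub> PIdl a"
      using irr add_PIdl(1)[OF Q(1) c] add_PIdl(1)[OF Q(1) a] by blast
    then show "a \<in> Q"
    proof cases
      case 1
      then have "?c \<in> Q" using add_PIdl(3)[OF Q(1) c] by blast
      then show ?thesis using bQ b by (auto simp: radical_def)
    next
      case 2
      then show ?thesis using add_PIdl(3)[OF Q(1) a] by blast
    qed
  qed
qed

text \<open>Noetherian induction: a maximal counterexample is neither the whole ring, which is the
  empty intersection, nor primary. It is therefore a proper intersection of two larger ideals, and
  their decompositions combine.\<close>

lemma (in cring) primary_decomposition_exists:
  assumes noeth: "noetherian_ring R" and I: "ideal I R"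
  shows "\<exists>S. finite S \<and> (\<forall>Q\<in>S. primary_ideal R Q) \<and> carrier R \<inter> \<Inter>S = I"
proof (rule ccontr)
  interpret N: noetherian_ring R by fact
  let ?D = "\<lambda>I. \<exists>S. finite S \<and> (\<forall>Q\<in>S. primary_ideal R Q) \<and> carrier R \<inter> \<Inter>S = I"
  let ?B = "{I. ideal I R \<and> \<not> ?D I}"
  assume "\<not> ?D I"
  then have "\<exists>M\<in>?B. \<forall>J\<in>?B. M \<subseteq> J \<longrightarrow> J = M"
    by (intro N.maximal_ideal_in_family) (use I in auto)
  then obtain M where MB: "M \<in> ?B" and max': "\<forall>J\<in>?B. M \<subseteq> J \<longrightarrow> J = M"
    by (rule bexE)
  then have M: "ideal M R" "\<not> ?D M" by simp_all
  have max: "J = M" if "J \<in> ?B" "M \<subseteq> J" for J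
    using max' that by (metis (no_types, lifting))
  have "M \<noteq> carrier R" using M(2) by (metis Inter_empty Int_UNIV_right empty_iff finite.emptyI)
  moreover have "\<not> primary_ideal R M"
  proof
    assume "primary_ideal R M"
    moreover have "carrier R \<inter> \<Inter>{M} = M" using ideal.Icarr[OF M(1)] by auto
    ultimately show False using M(2) by (metis finite.emptyI finite_insert singletonD)
  qed
  ultimately obtain A B where AB: "ideal A R" "ideal B R" "M = A \<inter> B" "M \<noteq> A" "M \<noteq> B"
    using irreducible_imp_primary[OF noeth M(1)] by blast
  then have "?D A" "?D B" using max[of A] max[of B] by blast+
  then obtain S T where "finite S" "\<forall>Q\<in>S. primary_ideal R Q" "carrier R \<inter> \<Inter>S = A"
    "finite T" "\<forall>Q\<in>T. primary_ideal R Q" "carrier R \<inter> \<Inter>T = B" by blast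
  then have "finite (S \<union> T) \<and> (\<forall>Q\<in>S \<union> T. primary_ideal R Q) \<and> carrier R \<inter> \<Inter>(S \<union> T) = M"
    unfolding AB(3) by auto
  then show False using M(2) by blast
qed

section \<open>Radicals of intersections and minimal primary decompositions\<close>

lemma (in cring) radical_Int:
  assumes "ideal I R" "ideal J R"
  shows "radical R (I \<inter> J) = radical R I \<inter> radical R J"
proof -
  have "a \<in> radical R (I \<inter> J)" if a: "a \<in> carrier R" "a [^] m \<in> I" "a [^] n \<in> J" for a and m n :: nat
  proof -
    have "a [^] (m + n) \<in> I \<inter> J"
      using that ideal.I_r_closed[OF assms(1), of "a [^] m" "a [^] n"]
        ideal.I_l_closed[OF assms(2), of "a [^] n" "a [^] m"]
      by (simp add: nat_pow_mult)
    then show ?thesis unfolding radical_def using a by blast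
  qed
  then show ?thesis by (auto simp: radical_def)
qed

text \<open>An element \<open>a\<close> outside the intersection misses one of the two ideals, and
  that ideal sends \<open>b\<close> into the common radical, which is also the radical of the
  intersection. This allows components to be merged.\<close>

lemma (in cring) primary_ideal_Int:
  assumes P: "primary_ideal R P" and Q: "primary_ideal R Q" and eq: "radical R P = radical R Q"
  shows "primary_ideal R (P \<inter> Q)"
proof -
  have id: "ideal P R" "ideal Q R" using P Q by (auto simp: primary_ideal_def)
  have "radical R (P \<inter> Q) = radical R P" using radical_Int[OF id] eq by simp
  moreover have "P \<inter> Q \<noteq> carrier R"
    using P ideal.Icarr[OF id(1)] by (auto simp: primary_ideal_def)
  ultimately show ?thesis
    using P Q eq i_intersect[OF id] unfolding primary_ideal_def by auto
qed

text \<open>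
  A primary decomposition with the least number of components is minimal: a redundant component
  could be dropped, and two components with the same radical could be merged.
\<close>

theorem (in cring) min_primary_decomposition_exists:
  assumes "noetherian_ring R" "ideal I R"
  shows "\<exists>S. min_primary_decomposition R I S"
proof -
  let ?D = "\<lambda>S. finite S \<and> (\<forall>Q\<in>S. primary_ideal R Q) \<and> carrier R \<inter> \<Inter>S = I"
  have "\<exists>S. ?D S" by (rule primary_decomposition_exists[OF assms])
  then obtain S where S: "?D S" and least: "\<And>T. ?D T \<Longrightarrow> card S \<le> card T"
    using ex_has_least_nat[of ?D _ card] by (metis (no_types, lifting))
  have "inj_on (radical R) S"
  proof (rule inj_onI, rule ccontr)
    fix P Q assume PQ: "P \<in> S" "Q \<in> S" "radical R P = radical R Q" "P \<noteq> Q"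
    let ?T = "insert (P \<inter> Q) (S - {P, Q})"
    have "\<Inter>?T = \<Inter>S" using PQ by blast
    then have "?D ?T" using S PQ primary_ideal_Int[of P Q] by auto
    then have "card S \<le> card ?T" by (rule least)
    \<comment> \<open>Only an inequality, since \<open>P \<inter> Q\<close> may already be one of
      the remaining components.\<close>
    also have "\<dots> \<le> Suc (card (S - {P, Q}))" by (rule card_insert_le_m1) simp_all
    also have "card (S - {P, Q}) = card S - 2" using PQ S by (subst card_Diff_subset) auto
    also have "Suc (card S - 2) < card S"
      using card_mono[of S "{P, Q}"] S PQ by auto
    finally show False by simp
  qed
  moreover have "carrier R \<inter> \<Inter>(S - {Q}) \<noteq> I" if "Q \<in> S" for Q
  proof
    assume "carrier R \<inter> \<Inter>(S - {Q}) = I"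
    then have "card S \<le> card (S - {Q})" using S by (intro least) auto
    then show False using that S by (metis card_Diff1_less leD)
  qed
  ultimately show ?thesis
    using S unfolding min_primary_decomposition_def by blast
qed

text \<open>Otherwise elements of the given ideals chosen outside the prime would have a product in
  the intersection, yet outside the prime. The empty intersection is the whole ring and cannot lie
  in a prime.\<close>

lemma (in primeideal) Inter_subsetD:
  assumes "finite S" "\<And>Q. Q \<in> S \<Longrightarrow> ideal Q R" "carrier R \<inter> \<Inter>S \<subseteq> I"
  shows "\<exists>Q\<in>S. Q \<subseteq> I"
  using assms
proof (induction S)
  case empty
  then have "carrier R \<subseteq> I" by simp
  then show ?case using I_notcarr Icarr by blast
next
  case (insert Q S)
  show ?case
  proof (rule ccontr)
    assume no: "\<not> ?thesis"
    then obtain a where a: "a \<in> Q" "a \<notin> I" by blast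
    have "\<not> carrier R \<inter> \<Inter>S \<subseteq> I" using insert no by blast
    then obtain b where b: "b \<in> carrier R" "\<And>P. P \<in> S \<Longrightarrow> b \<in> P" "b \<notin> I" by blast
    have ac: "a \<in> carrier R" using a insert.prems(1)[of Q] ideal.Icarr by fastforce
    have "a \<otimes> b \<in> P" if "P \<in> insert Q S" for P
      using that a b ac insert.prems(1)[OF that] ideal.I_l_closed ideal.I_r_closed
      by (metis insertE)
    then have "a \<otimes> b \<in> I" using insert.prems(2) ac b by blast
    then show False using I_prime ac a b by blast
  qed
qed

section \<open>Primary ideals inside a prime and the component belonging to it\<close>

lemma (in primeideal) power_memD:
  assumes "a \<in> carrier R" "a [^] (n::nat) \<in> I"
  shows "a \<in> I"
  using assms(2)
proof (induction n)
  case 0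
  then show ?case using I_notcarr one_imp_carrier by simp
next
  case (Suc n)
  then show ?case using I_prime[of "a [^] n" a] assms(1) by auto
qed

lemma (in primeideal) radical_subset:
  assumes "Q \<subseteq> I"
  shows "radical R Q \<subseteq> I"
  using assms power_memD by (auto simp: radical_def)

text \<open>The hypothesis \<open>loc\<close> says that \<open>J\<close> and \<open>P\<close> become equal in the localization at \<open>P\<close>.\<close>

lemma (in cring) primary_ideal_eq_prime_if_locally_eq:
  assumes P: "primeideal P R" and JQ: "J \<subseteq> Q" and Q: "primary_ideal R Q"
    and rad: "radical R Q \<subseteq> P"
    and loc: "\<And>y. y \<in> Y \<Longrightarrow> y \<in> carrier R \<and> (\<exists>u\<in>carrier R - P. y \<otimes> u \<in> J)"
    and gen: "P = Idl Y"
  shows "Q = P"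
proof
  interpret P: primeideal P R by fact
  have "Y \<subseteq> Q"
  proof
    fix y assume "y \<in> Y"
    with loc obtain u where "y \<in> carrier R" "u \<in> carrier R" "u \<notin> P" "y \<otimes> u \<in> J" by blast
    \<comment> \<open>Since \<open>u\<close> is outside \<open>P\<close>, it is outside the radical
      of \<open>Q\<close>, so the primary ideal \<open>Q\<close> must contain the other factor
      \<open>y\<close>.\<close>
    then show "y \<in> Q" using JQ Q rad unfolding primary_ideal_def by blast
  qed
  then show "P \<subseteq> Q" unfolding gen using Q by (intro genideal_minimal) (auto simp: primary_ideal_def)
  have "Q \<subseteq> radical R Q"
  proof
    fix x assume "x \<in> Q"
    moreover from this have "x \<in> carrier R"
      using Q ideal.Icarr by (fastforce simp: primary_ideal_def)
    moreover from this have "x [^] (1::nat) = x" by simp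
    ultimately show "x \<in> radical R Q" unfolding radical_def by (metis (mono_tags, lifting) mem_Collect_eq)
  qed
  then show "Q \<subseteq> P" using rad by blast
qed

lemma (in cring) primeideal_imp_primary:
  assumes "primeideal Q R"
  shows "primary_ideal R Q" "radical R Q \<subseteq> Q"
proof -
  interpret Q: primeideal Q R by fact
  have "x \<in> radical R Q" if "x \<in> Q" for x
  proof -
    have "x \<in> carrier R" "x [^] (1::nat) \<in> Q" using that Q.Icarr by auto
    then show ?thesis unfolding radical_def by blast
  qed
  then show "primary_ideal R Q"
    unfolding primary_ideal_def using Q.I_notcarr Q.I_prime Q.is_ideal by blast
  show "radical R Q \<subseteq> Q" by (rule Q.radical_subset) simp
qed

text \<open>Everything reduces to one fact: a primary ideal above \<open>J\<close> with radical
  inside \<open>P\<close> is \<open>P\<close>. It applies to a prime between \<open>J\<close> and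
  \<open>P\<close>, to a component contained in \<open>P\<close> (one exists because
  \<open>P\<close> is prime), and to a component with radical \<open>P\<close>.\<close>

theorem (in cring) minimal_prime_component_if_locally_eq:
  assumes noeth: "noetherian_ring R" and J: "ideal J R"
    and P: "primeideal P R" and JP: "J \<subseteq> P" and gen: "P = Idl Y"
    and loc: "\<And>y. y \<in> Y \<Longrightarrow> y \<in> carrier R \<and> (\<exists>u\<in>carrier R - P. y \<otimes> u \<in> J)"
  shows "minimal_prime R J P" "primary_component R J P"
    "\<And>Q. primary_component R J Q \<Longrightarrow> radical R Q = P \<Longrightarrow> Q = P"
proof -
  interpret P: primeideal P R by fact
  note eqP = primary_ideal_eq_prime_if_locally_eq[OF P _ _ _ loc gen]
  show "minimal_prime R J P"
    unfolding minimal_prime_def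
  proof (intro conjI allI impI P JP)
    fix Q assume "primeideal Q R" "J \<subseteq> Q" "Q \<subseteq> P"
    then show "Q = P" using primeideal_imp_primary by (intro eqP) blast+
  qed
  have sub: "J \<subseteq> Q" "primary_ideal R Q" if "min_primary_decomposition R J S" "Q \<in> S" for S Q
    using that unfolding min_primary_decomposition_def by blast+
  obtain S where S: "min_primary_decomposition R J S"
    using min_primary_decomposition_exists[OF noeth J] by blast
  then have "\<exists>Q\<in>S. Q \<subseteq> P"
    using JP by (intro P.Inter_subsetD) (auto simp: min_primary_decomposition_def primary_ideal_def)
  then obtain Q where Q: "Q \<in> S" "Q \<subseteq> P" by blast
  then have "Q = P" using sub[OF S Q(1)] P.radical_subset by (intro eqP) blast+
  then show "primary_component R J P" using S Q by (auto simp: primary_component_def)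
  show "Q = P" if "primary_component R J Q" "radical R Q = P" for Q
    using that sub unfolding primary_component_def by (intro eqP) blast+
qed

section \<open>Monomial orders and Hilbert's basis theorem\<close>

lemma nat_seq_mono_subseq:
  fixes s :: "nat \<Rightarrow> nat"
  obtains r :: "nat \<Rightarrow> nat" where "strict_mono r" "mono (\<lambda>n. s (r n))"
proof -
  obtain f where f: "strict_mono f" "monoseq (\<lambda>n. s (f n))"
    using seq_monosub[of s] by blast
  show ?thesis
  proof (cases "incseq (\<lambda>n. s (f n))")
    case True
    then show ?thesis using that f(1) by (simp add: incseq_def mono_def)
  next
    case False
    with f(2) have dec: "s (f n) \<le> s (f m)" if "m \<le> n" for m n
      using that by (auto simp: monoseq_def incseq_def)
    \<comment> \<open>The remaining subsequence is nonincreasing, so from an index where its minimum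
      is attained it stays constant.\<close>
    obtain N where N: "\<And>n. s (f N) \<le> s (f n)"
      using ex_has_least_nat[of "\<lambda>_. True" _ "\<lambda>n. s (f n)"] by auto
    have "s (f (N + n)) = s (f N)" for n
      by (rule antisym) (simp_all add: dec N)
    then have "mono (\<lambda>n. s (f (N + n)))" by (simp add: mono_def)
    moreover have "strict_mono (\<lambda>n. f (N + n))"
      using f(1) by (simp add: strict_mono_def)
    ultimately show ?thesis using that by blast
  qed
qed

text \<open>The variables are treated one at a time. Passing to a further subsequence for a new
  variable keeps the exponents of the earlier ones monotone.\<close>

lemma dickson_subseq:
  fixes m :: "nat \<Rightarrow> 'v \<Rightarrow> nat"
  assumes "finite X"
  shows "\<exists>r :: nat \<Rightarrow> nat. strict_mono r \<and> (\<forall>x\<in>X. mono (\<lambda>n. m (r n) x))"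
  using assms
proof (induction X)
  case empty
  show ?case by (intro exI[of _ id]) (simp add: strict_mono_def)
next
  case (insert y X)
  then obtain r :: "nat \<Rightarrow> nat" where r: "strict_mono r" "\<And>x. x \<in> X \<Longrightarrow> mono (\<lambda>n. m (r n) x)" by blast
  obtain t :: "nat \<Rightarrow> nat" where t: "strict_mono t" "mono (\<lambda>n. m (r (t n)) y)"
    using nat_seq_mono_subseq[of "\<lambda>n. m (r n) y"] .
  have "mono (\<lambda>n. m (r (t n)) x)" if "x \<in> X" for x
    using r(2)[OF that] t(1) by (simp add: mono_def strict_mono_less_eq)
  moreover have "strict_mono (\<lambda>n. r (t n))"
    using r(1) t(1) by (simp add: strict_mono_def)
  ultimately show ?case using t(2) by (intro exI[of _ "\<lambda>n. r (t n)"]) auto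
qed

corollary dickson:
  fixes m :: "nat \<Rightarrow> ('v \<Rightarrow>\<^sub>0 nat)"
  assumes "finite X" "\<And>n. Poly_Mapping.keys (m n) \<subseteq> X"
  obtains i j d where "i < j" "m j = d + m i" "Poly_Mapping.keys d \<subseteq> X"
proof -
  obtain r :: "nat \<Rightarrow> nat" where r: "strict_mono r" "\<And>x. x \<in> X \<Longrightarrow> mono (\<lambda>n. Poly_Mapping.lookup (m (r n)) x)"
    using dickson_subseq[OF assms(1), of "\<lambda>n. Poly_Mapping.lookup (m n)"] by blast
  have le: "Poly_Mapping.lookup (m (r 0)) x \<le> Poly_Mapping.lookup (m (r 1)) x" for x
  proof (cases "x \<in> X")
    case True
    then show ?thesis using r(2)[OF True] by (simp add: mono_def)
  next
    case False
    then have "x \<notin> Poly_Mapping.keys (m (r 0))" using assms(2)[of "r 0"] by blast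
    then show ?thesis by (simp add: in_keys_iff)
  qed
  \<comment> \<open>Subtraction of exponents is truncated at 0; \<open>le\<close> makes it
    exact.\<close>
  define d where "d = m (r 1) - m (r 0)"
  have "m (r 1) = d + m (r 0)"
    by (rule poly_mapping_eqI) (use le in \<open>simp add: d_def lookup_add lookup_minus\<close>)
  moreover have "Poly_Mapping.keys d \<subseteq> X"
    using assms(2)[of "r 1"] by (auto simp: d_def in_keys_iff lookup_minus)
  moreover have "r 0 < r 1" using r(1) by (simp add: strict_mono_def)
  ultimately show ?thesis using that by blast
qed

text \<open>The order is encoded by an additive rank \<open>w\<close> instead of a relation, so
  multiplying monomials becomes adding ranks. Injectivity on the monomials over \<open>X\<close>
  excludes ties there, and nonnegativity makes multiples at least as large.\<close>

locale monomial_order =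
  fixes X :: "'v set"
    and w :: "('v \<Rightarrow>\<^sub>0 nat) \<Rightarrow> 'o::{linordered_cancel_ab_semigroup_add, comm_monoid_add, ordered_comm_monoid_add}"
  assumes finite_vars: "finite X"
    and w_add: "w (a + b) = w a + w b"
    and w_nonneg: "0 \<le> w a"
    and w_inj: "inj_on w {m. Poly_Mapping.keys m \<subseteq> X}"
begin

lemma w_eqD:
  "w a = w b \<Longrightarrow> Poly_Mapping.keys a \<subseteq> X \<Longrightarrow> Poly_Mapping.keys b \<subseteq> X \<Longrightarrow> a = b"
  using w_inj by (auto simp: inj_on_def)

text \<open>By Dickson's lemma a descending chain would contain a monomial dividing a later one, but
  a multiple never has smaller rank.\<close>

lemma wf_w:
  "wf {(a, b). Poly_Mapping.keys a \<subseteq> X \<and> Poly_Mapping.keys b \<subseteq> X \<and> w a < w b}"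
  unfolding wf_iff_no_infinite_down_chain
proof
  assume "\<exists>s. \<forall>i. (s (Suc i), s i) \<in>
    {(a, b). Poly_Mapping.keys a \<subseteq> X \<and> Poly_Mapping.keys b \<subseteq> X \<and> w a < w b}"
  then obtain s where "\<forall>i. (s (Suc i), s i) \<in>
    {(a, b). Poly_Mapping.keys a \<subseteq> X \<and> Poly_Mapping.keys b \<subseteq> X \<and> w a < w b}" ..
  then have s: "Poly_Mapping.keys (s i) \<subseteq> X" "w (s (Suc i)) < w (s i)" for i by simp_all
  have dec: "w (s j) < w (s i)" if "i < j" for i j
    using that by (induction rule: less_Suc_induct) (rule s(2), rule less_trans)
  obtain i j d where ij: "i < j" "s j = d + s i"
    using dickson[OF finite_vars, of s, OF s(1)] .
  have "0 + w (s i) \<le> w d + w (s i)" by (intro add_right_mono w_nonneg)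
  then show False using dec[OF ij(1)] unfolding ij(2) w_add by simp
qed

lemma ex_max_monomial:
  assumes "finite K" "K \<noteq> {}"
  obtains m where "m \<in> K" "\<And>n. n \<in> K \<Longrightarrow> w n \<le> w m"
proof -
  have "Max (w ` K) \<in> w ` K" using assms by simp
  then obtain m where "m \<in> K" "w m = Max (w ` K)" by auto
  then show ?thesis using that assms(1) by simp
qed

text \<open>The leading monomial. The choice is unique for nonzero polynomials over
  \<open>X\<close>, because \<open>w\<close> is injective there; at 0 the value is
  unspecified.\<close>

definition lead :: "('v, 'k::zero) mpol \<Rightarrow> ('v \<Rightarrow>\<^sub>0 nat)" where
  "lead f = (SOME m. m \<in> Poly_Mapping.keys f \<and> (\<forall>n\<in>Poly_Mapping.keys f. w n \<le> w m))"

lemma lead: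
  assumes "f \<noteq> 0"
  shows "lead f \<in> Poly_Mapping.keys f" "n \<in> Poly_Mapping.keys f \<Longrightarrow> w n \<le> w (lead f)"
proof -
  have "Poly_Mapping.keys f \<noteq> {}" using assms by (metis in_keys_iff empty_iff lookup_zero poly_mapping_eqI)
  then have "\<exists>m. m \<in> Poly_Mapping.keys f \<and> (\<forall>n\<in>Poly_Mapping.keys f. w n \<le> w m)"
    using ex_max_monomial[of "Poly_Mapping.keys f"] by (metis finite_keys)
  then have "lead f \<in> Poly_Mapping.keys f \<and> (\<forall>n\<in>Poly_Mapping.keys f. w n \<le> w (lead f))"
    unfolding lead_def by (rule someI_ex)
  then show "lead f \<in> Poly_Mapping.keys f" "n \<in> Poly_Mapping.keys f \<Longrightarrow> w n \<le> w (lead f)"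
    by blast+
qed

end

text \<open>The order compares two maps at the first position where they differ; against 0 this is
  the least key of \<open>p\<close>, where \<open>p\<close> is positive.\<close>

lemma poly_mapping_nat_nonneg: "0 \<le> (p :: 'a::linorder \<Rightarrow>\<^sub>0 nat)"
proof (cases "p = 0")
  case False
  then have ne: "Poly_Mapping.keys p \<noteq> {}" by (metis in_keys_iff empty_iff lookup_zero poly_mapping_eqI)
  define k where "k = Min (Poly_Mapping.keys p)"
  have k: "k \<in> Poly_Mapping.keys p" using ne by (simp add: k_def)
  have "Poly_Mapping.lookup p l = 0" if "l < k" for l
    using that ne by (auto simp: k_def in_keys_iff)
  with k have "less_fun (Poly_Mapping.lookup 0) (Poly_Mapping.lookup p)"
    unfolding less_fun_def by (intro exI[of _ k]) (auto simp: in_keys_iff)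
  then show ?thesis by (simp add: less_eq_poly_mapping.rep_eq)
qed simp

text \<open>
  Renaming the finitely many variables to natural numbers turns the lexicographic order on
  finitely supported maps into a monomial order.
\<close>

lemma monomial_order_exists:
  assumes "finite (X :: 'v set)"
  obtains w :: "('v \<Rightarrow>\<^sub>0 nat) \<Rightarrow> (nat \<Rightarrow>\<^sub>0 nat)" where "monomial_order X w"
proof -
  obtain g :: "'v \<Rightarrow> nat" where g: "inj_on g X"
    using finite_imp_inj_to_nat_seg[OF assms] by blast
  \<comment> \<open>Exponents outside \<open>X\<close> are dropped, which is why injectivity is
    claimed for monomials over \<open>X\<close> alone.\<close>
  define w where "w m = (\<Sum>x\<in>X. Poly_Mapping.single (g x) (Poly_Mapping.lookup m x))" for m :: "'v \<Rightarrow>\<^sub>0 nat"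
  have look: "Poly_Mapping.lookup (w m) (g x) = Poly_Mapping.lookup m x" if "x \<in> X" for m x
  proof -
    have "Poly_Mapping.lookup (w m) (g x) = (\<Sum>y\<in>X. if y = x then Poly_Mapping.lookup m y else 0)"
      unfolding w_def lookup_sum lookup_single using g that
      by (intro sum.cong refl) (auto simp: when_def inj_on_def)
    then show ?thesis using assms that by simp
  qed
  have "monomial_order X w"
  proof
    show "w (a + b) = w a + w b" for a b
      by (simp add: w_def lookup_add single_add sum.distrib)
    show "inj_on w {m. Poly_Mapping.keys m \<subseteq> X}"
    proof (rule inj_onI, rule poly_mapping_eqI)
      fix a b x assume ab: "a \<in> {m. Poly_Mapping.keys m \<subseteq> X}" "b \<in> {m. Poly_Mapping.keys m \<subseteq> X}" "w a = w b"
      show "Poly_Mapping.lookup a x = Poly_Mapping.lookup b x"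
      proof (cases "x \<in> X")
        case True
        then show ?thesis using look[of x a] look[of x b] ab(3) by simp
      next
        case False
        then have "x \<notin> Poly_Mapping.keys a" "x \<notin> Poly_Mapping.keys b" using ab by auto
        then show ?thesis by (simp add: in_keys_iff)
      qed
    qed
  qed (use assms poly_mapping_nat_nonneg in auto)
  then show ?thesis by (rule that)
qed

text \<open>With only one way to write \<open>m + n\<close> as a product of occurring monomials,
  nothing can cancel. This covers multiplication by a single term as well as the product of extremal
  monomials in the primality proof below.\<close>

lemma lookup_mult_unique:
  fixes f g :: "'a::comm_monoid_add \<Rightarrow>\<^sub>0 'b::comm_semiring_0"
  assumes uniq: "\<And>a b. a \<in> Poly_Mapping.keys f \<Longrightarrow> b \<in> Poly_Mapping.keys g \<Longrightarrow> a + b = m + n \<Longrightarrow> a = m \<and> b = n"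
  shows "Poly_Mapping.lookup (f * g) (m + n) = Poly_Mapping.lookup f m * Poly_Mapping.lookup g n"
proof -
  \<comment> \<open>Inserting \<open>m\<close> and \<open>n\<close> covers the case that one of them
    does not occur; its coefficient is then 0.\<close>
  let ?F = "insert m (Poly_Mapping.keys f)" and ?G = "insert n (Poly_Mapping.keys g)"
  have "f * g = (\<Sum>a\<in>Poly_Mapping.keys f. Poly_Mapping.single a (Poly_Mapping.lookup f a)) *
      (\<Sum>b\<in>Poly_Mapping.keys g. Poly_Mapping.single b (Poly_Mapping.lookup g b))"
    by (simp only: mpol_expand)
  also have "\<dots> = (\<Sum>a\<in>?F. Poly_Mapping.single a (Poly_Mapping.lookup f a)) *
      (\<Sum>b\<in>?G. Poly_Mapping.single b (Poly_Mapping.lookup g b))"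
    by (intro arg_cong2[where f = "(*)"] sum.mono_neutral_left) (auto simp: in_keys_iff)
  finally have "Poly_Mapping.lookup (f * g) (m + n) =
      (\<Sum>a\<in>?F. \<Sum>b\<in>?G. (Poly_Mapping.lookup f a * Poly_Mapping.lookup g b when a + b = m + n))"
    by (simp only: sum_product mult_single lookup_sum lookup_single)
  also have "\<dots> = (\<Sum>a\<in>?F. \<Sum>b\<in>?G. if a = m \<and> b = n then Poly_Mapping.lookup f m * Poly_Mapping.lookup g n else 0)"
  proof (intro sum.cong refl)
    fix a b
    show "(Poly_Mapping.lookup f a * Poly_Mapping.lookup g b when a + b = m + n) =
      (if a = m \<and> b = n then Poly_Mapping.lookup f m * Poly_Mapping.lookup g n else 0)"
      using uniq[of a b] by (cases "a \<in> Poly_Mapping.keys f \<and> b \<in> Poly_Mapping.keys g")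
        (auto simp: when_def in_keys_iff)
  qed
  also have "\<dots> = (\<Sum>a\<in>?F. if a = m then (\<Sum>b\<in>?G. if b = n then Poly_Mapping.lookup f m * Poly_Mapping.lookup g n else 0) else 0)"
    by (intro sum.cong refl) auto
  also have "\<dots> = Poly_Mapping.lookup f m * Poly_Mapping.lookup g n"
    by (simp del: sum.insert sum.insert_remove)
  finally show ?thesis .
qed

lemma lookup_single_mult:
  fixes f :: "('v, 'k::comm_semiring_0) mpol"
  shows "Poly_Mapping.lookup (Poly_Mapping.single d c * f) (d + n) = c * Poly_Mapping.lookup f n"
  by (subst lookup_mult_unique) (auto split: if_splits)

section \<open>Ideal arithmetic in polynomial rings and Hilbert's basis theorem\<close>

lemma mpoly_ideal:
  fixes I :: "('v, 'k::comm_ring_1) mpol set"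
  assumes "ideal I (mpoly_ring X)"
  shows mpoly_ideal_zero: "0 \<in> I"
    and mpoly_ideal_add: "\<And>a b. a \<in> I \<Longrightarrow> b \<in> I \<Longrightarrow> a + b \<in> I"
    and mpoly_ideal_mult: "\<And>a b. a \<in> I \<Longrightarrow> mvars b \<subseteq> X \<Longrightarrow> b * a \<in> I"
    and mpoly_ideal_diff: "\<And>a b. a \<in> I \<Longrightarrow> b \<in> I \<Longrightarrow> a - b \<in> I"
    and mpoly_ideal_mvars: "\<And>a. a \<in> I \<Longrightarrow> mvars a \<subseteq> X"
    and mpoly_ideal_sum: "\<And>A h. (\<And>i. i \<in> A \<Longrightarrow> h i \<in> I) \<Longrightarrow> sum h A \<in> I"
proof -
  interpret I: ideal I "mpoly_ring X" by fact
  show zero: "0 \<in> I" using additive_subgroup.zero_closed[OF I.is_additive_subgroup] by simp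
  show add: "a + b \<in> I" if "a \<in> I" "b \<in> I" for a b using additive_subgroup.a_closed[OF I.is_additive_subgroup that] by simp
  show mult: "b * a \<in> I" if "a \<in> I" "mvars b \<subseteq> X" for a b
    using I.I_l_closed[of a b] that by simp
  show "a - b \<in> I" if "a \<in> I" "b \<in> I" for a b
    using add[OF that(1) mult[OF that(2), of "-1"]] by simp
  show "mvars a \<subseteq> X" if "a \<in> I" for a using I.Icarr[OF that] by simp
  show "sum h A \<in> I" if "\<And>i. i \<in> A \<Longrightarrow> h i \<in> I" for h :: "'c \<Rightarrow> _" and A
    using that by (induction A rule: infinite_finite_induct) (auto intro: zero add)
qed

lemma mpoly_idealI:
  fixes I :: "('v, 'k::comm_ring_1) mpol set"
  assumes "0 \<in> I" "\<And>a. a \<in> I \<Longrightarrow> mvars a \<subseteq> X"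
    and "\<And>a b. a \<in> I \<Longrightarrow> b \<in> I \<Longrightarrow> a + b \<in> I"
    and mult: "\<And>a b. a \<in> I \<Longrightarrow> mvars b \<subseteq> X \<Longrightarrow> b * a \<in> I"
  shows "ideal I (mpoly_ring X)"
proof -
  interpret R: cring "mpoly_ring X :: ('v, 'k) mpol ring" by (rule cring_mpoly_ring)
  show ?thesis
  proof (intro idealI R.ring_axioms R.add.subgroupI)
    fix a assume a: "a \<in> I"
    then have "\<ominus>\<^bsub>mpoly_ring X\<^esub> a = - a" using assms(2) by (intro R.minus_equality) auto
    then show "\<ominus>\<^bsub>mpoly_ring X\<^esub> a \<in> I" using mult[OF a, of "-1"] by simp
  qed (use assms in \<open>auto simp: mult.commute\<close>)
qed

lemma mvars_single: "mvars (Poly_Mapping.single m c) \<subseteq> Poly_Mapping.keys m"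
  by (auto simp: mvars_def split: if_splits)

lemma keys_subset_mvars: "m \<in> Poly_Mapping.keys p \<Longrightarrow> Poly_Mapping.keys m \<subseteq> mvars p"
  by (auto simp: mvars_def)

text \<open>
  If an ideal is not finitely generated, choose its elements one after the other with minimal leading
  monomial outside the ideal generated so far. By Dickson's lemma one leading monomial divides
  a later one, and a reduction step contradicts the minimality of the latter.
\<close>

theorem noetherian_mpoly_ring:
  assumes "finite (X :: 'v set)"
  shows "noetherian_ring (mpoly_ring X :: ('v, 'k::field) mpol ring)"
proof -
  let ?R = "mpoly_ring X :: ('v, 'k) mpol ring"
  interpret R: cring ?R by (rule cring_mpoly_ring)
  obtain w :: "('v \<Rightarrow>\<^sub>0 nat) \<Rightarrow> (nat \<Rightarrow>\<^sub>0 nat)" where "monomial_order X w"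
    using monomial_order_exists[OF assms] .
  then interpret monomial_order X w .
  show ?thesis
  proof (rule R.noetherian_ringI)
    fix I assume I: "ideal I ?R"
    note Imem = mpoly_ideal[OF I]
    have lead_X: "Poly_Mapping.keys (lead f) \<subseteq> X" if "f \<in> I" "f \<noteq> 0" for f
      using Imem(5)[OF that(1)] keys_subset_mvars[OF lead(1)[OF that(2)]] by blast
    show "\<exists>A\<subseteq>carrier ?R. finite A \<and> I = Idl\<^bsub>?R\<^esub> A"
    proof (rule ccontr)
      assume no: "\<not> ?thesis"
      have Icarr: "I \<subseteq> carrier ?R" using Imem(5) by auto
      have ex: "\<exists>f. f \<in> I \<and> f \<notin> Idl\<^bsub>?R\<^esub> A \<and> (\<forall>g. g \<in> I \<longrightarrow> w (lead g) < w (lead f) \<longrightarrow> g \<in> Idl\<^bsub>?R\<^esub> A)"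
        if A: "finite A" "A \<subseteq> I" for A
      proof -
        have AI: "Idl\<^bsub>?R\<^esub> A \<subseteq> I" using A(2) by (rule R.genideal_minimal[OF I])
        have Aid: "ideal (Idl\<^bsub>?R\<^esub> A) ?R" using A(2) Icarr by (intro R.genideal_ideal) auto
        have nz: "f \<noteq> 0" if "f \<notin> Idl\<^bsub>?R\<^esub> A" for f
          using that mpoly_ideal_zero[OF Aid] by blast
        have "Idl\<^bsub>?R\<^esub> A \<noteq> I" using no A Icarr by blast
        then obtain f0 where "f0 \<in> I - Idl\<^bsub>?R\<^esub> A" using AI by blast
        then have "lead f0 \<in> lead ` (I - Idl\<^bsub>?R\<^esub> A)" by blast
        then obtain m where m: "m \<in> lead ` (I - Idl\<^bsub>?R\<^esub> A)"
          and min: "\<And>n. (n, m) \<in> {(a, b). Poly_Mapping.keys a \<subseteq> X \<and> Poly_Mapping.keys b \<subseteq> X \<and> w a < w b} \<Longrightarrow>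
            n \<notin> lead ` (I - Idl\<^bsub>?R\<^esub> A)"
          by (erule wfE_min[OF wf_w])
        then obtain f where f: "f \<in> I" "f \<notin> Idl\<^bsub>?R\<^esub> A" "m = lead f" by blast
        have "g \<in> Idl\<^bsub>?R\<^esub> A" if "g \<in> I" "w (lead g) < w (lead f)" for g
        proof (rule ccontr)
          assume "g \<notin> Idl\<^bsub>?R\<^esub> A"
          then show False using min[of "lead g"] that f nz lead_X by blast
        qed
        then show ?thesis using f by blast
      qed
      then obtain c where c: "\<And>A. finite A \<Longrightarrow> A \<subseteq> I \<Longrightarrow> c A \<in> I \<and> c A \<notin> Idl\<^bsub>?R\<^esub> A \<and>
          (\<forall>g. g \<in> I \<longrightarrow> w (lead g) < w (lead (c A)) \<longrightarrow> g \<in> Idl\<^bsub>?R\<^esub> A)" by metis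
      \<comment> \<open>\<open>S n\<close> collects the elements chosen in the first
        \<open>n\<close> rounds, so \<open>F i\<close> lies in \<open>S j\<close> as soon as
        \<open>i < j\<close>.\<close>
      define S where "S = rec_nat {} (\<lambda>_ A. insert (c A) A)"
      have S_Suc: "S (Suc n) = insert (c (S n)) (S n)" and S_0: "S 0 = {}" for n
        by (simp_all add: S_def)
      have S: "finite (S n) \<and> S n \<subseteq> I" for n
        by (induction n) (use c in \<open>auto simp: S_0 S_Suc\<close>)
      define F where "F n = c (S n)" for n
      have F: "F n \<in> I" "F n \<notin> Idl\<^bsub>?R\<^esub> (S n)"
        and Fmin: "\<And>g. g \<in> I \<Longrightarrow> w (lead g) < w (lead (F n)) \<Longrightarrow> g \<in> Idl\<^bsub>?R\<^esub> (S n)" for n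
        using c[of "S n"] S[of n] by (auto simp: F_def)
      have FS: "F i \<in> S j" if "i < j" for i j
        using that by (induction j) (auto simp: S_Suc F_def less_Suc_eq)
      have Sid: "ideal (Idl\<^bsub>?R\<^esub> (S n)) ?R" for n
        using S[of n] Icarr by (intro R.genideal_ideal) auto
      have nz: "f \<noteq> 0" if "f \<notin> Idl\<^bsub>?R\<^esub> (S n)" for f n
        using that mpoly_ideal_zero[OF Sid] by blast
      have F0: "F n \<noteq> 0" for n using nz[OF F(2)] .
      obtain i j d where ij: "i < j" "lead (F j) = d + lead (F i)" "Poly_Mapping.keys d \<subseteq> X"
        using dickson[OF assms, of "\<lambda>n. lead (F n)", OF lead_X[OF F(1) F0]] .
      \<comment> \<open>With this quotient of leading coefficients, \<open>h = F j - g\<close> loses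
        the leading term of \<open>F j\<close>. It stays outside the ideal generated by
        \<open>S j\<close>, because \<open>g\<close> lies inside.\<close>
      define c' where "c' = Poly_Mapping.lookup (F j) (lead (F j)) / Poly_Mapping.lookup (F i) (lead (F i))"
      have ci: "Poly_Mapping.lookup (F i) (lead (F i)) \<noteq> 0"
        using lead(1)[OF F0[of i]] by (simp add: in_keys_iff)
      define g where "g = Poly_Mapping.single d c' * F i"
      define h where "h = F j - g"
      have dX: "mvars (Poly_Mapping.single d c') \<subseteq> X" by (rule order.trans[OF mvars_single ij(3)])
      have "F i \<in> Idl\<^bsub>?R\<^esub> (S j)"
      proof -
        have "S j \<subseteq> carrier ?R" using S[of j] Icarr by blast
        then show ?thesis using FS[OF ij(1)] R.genideal_self by blast
      qed
      then have gS: "g \<in> Idl\<^bsub>?R\<^esub> (S j)"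
        unfolding g_def by (intro mpoly_ideal_mult[OF Sid] dX)
      have "h \<in> I" unfolding h_def g_def by (intro Imem F dX)
      have hS: "h \<notin> Idl\<^bsub>?R\<^esub> (S j)"
        using mpoly_ideal_add[OF Sid _ gS, of h] F(2)[of j] by (auto simp: h_def)
      have h0: "h \<noteq> 0" by (rule nz[OF hS])
      have "w (lead h) \<le> w (lead (F j))"
      proof -
        have "lead h \<in> Poly_Mapping.keys (F j) \<union> Poly_Mapping.keys g"
          using lead(1)[OF h0] keys_diff[of "F j" g] unfolding h_def by blast
        then consider "lead h \<in> Poly_Mapping.keys (F j)"
          | n where "n \<in> Poly_Mapping.keys (F i)" "lead h = d + n"
          using keys_mult[of "Poly_Mapping.single d c'" "F i"] by (auto simp: g_def split: if_splits)
        then show ?thesis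
        proof cases
          case 1
          then show ?thesis using lead(2)[OF F0] by blast
        next
          case 2
          then show ?thesis using lead(2)[OF F0 2(1)] by (simp add: w_add ij(2) add_left_mono)
        qed
      qed
      moreover have "Poly_Mapping.lookup h (lead (F j)) = 0"
        using ci by (simp add: h_def g_def lookup_minus ij(2) lookup_single_mult)
          (simp add: c'_def ij(2))
      then have "lead h \<noteq> lead (F j)" using lead(1)[OF h0] by (auto simp: in_keys_iff)
      then have "w (lead h) \<noteq> w (lead (F j))"
        using w_eqD[of "lead h" "lead (F j)"] lead_X \<open>h \<in> I\<close> h0 F(1) F0 by blast
      ultimately have "h \<in> Idl\<^bsub>?R\<^esub> (S j)" using Fmin[OF \<open>h \<in> I\<close>] by simp
      then show False using hS by simp
    qed
  qed
qed

section \<open>Ideals generated by squarefree monomials\<close>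

definition squarefree_monom :: "'v set \<Rightarrow> ('v \<Rightarrow>\<^sub>0 nat)" where
  "squarefree_monom e = (\<Sum>x\<in>e. Poly_Mapping.single x 1)"

lemma lookup_squarefree_monom:
  assumes "finite e"
  shows "Poly_Mapping.lookup (squarefree_monom e) y = (if y \<in> e then 1 else 0)"
  using assms by (simp add: squarefree_monom_def lookup_sum lookup_single when_def)

lemma keys_squarefree_monom [simp]:
  assumes "finite e"
  shows "Poly_Mapping.keys (squarefree_monom e) = e"
  using assms by (auto simp: in_keys_iff lookup_squarefree_monom split: if_splits)

lemma prod_mvar:
  assumes "finite e"
  shows "(\<Prod>x\<in>e. mvar x :: ('v, 'k::comm_ring_1) mpol) = Poly_Mapping.single (squarefree_monom e) 1"
  using assms by (induction e) (simp_all add: squarefree_monom_def mvar_def mult_single)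

lemma mvars_squarefree_monom [simp]:
  assumes "finite e"
  shows "mvars (Poly_Mapping.single (squarefree_monom e) (1 :: 'k::comm_ring_1)) = e"
  using assms by (simp add: mvars_def)

lemma keys_add_nat: "Poly_Mapping.keys (a + b :: 'v \<Rightarrow>\<^sub>0 nat) = Poly_Mapping.keys a \<union> Poly_Mapping.keys b"
  by (auto simp: in_keys_iff lookup_add)

text \<open>Membership in a monomial ideal is decided term by term: the polynomials passing the test
  form an ideal containing the generators, and each term of such a polynomial is a multiple of a
  generator.\<close>

lemma mem_edge_ideal_iff:
  fixes f :: "('v, 'k::comm_ring_1) mpol"
  assumes E: "E \<subseteq> Pow X" and fin: "\<And>e. e \<in> E \<Longrightarrow> finite e"
  shows "f \<in> edge_ideal X E \<longleftrightarrow>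
    mvars f \<subseteq> X \<and> (\<forall>m\<in>Poly_Mapping.keys f. \<exists>e\<in>E. e \<subseteq> Poly_Mapping.keys m)"
proof -
  let ?R = "mpoly_ring X :: ('v, 'k) mpol ring"
  let ?M = "{f :: ('v, 'k) mpol. mvars f \<subseteq> X \<and> (\<forall>m\<in>Poly_Mapping.keys f. \<exists>e\<in>E. e \<subseteq> Poly_Mapping.keys m)}"
  let ?G = "(\<lambda>e. \<Prod>x\<in>e. mvar x :: ('v, 'k) mpol) ` E"
  interpret R: cring ?R by (rule cring_mpoly_ring)
  have G: "?G \<subseteq> carrier ?R" using E fin by (auto simp: prod_mvar)
  have id: "ideal (edge_ideal X E) ?R"
    unfolding edge_ideal_def using G by (rule R.genideal_ideal)
  have "ideal ?M ?R"
  proof (rule mpoly_idealI)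
    fix a b assume a: "a \<in> ?M" and b: "b \<in> ?M"
    show "a + b \<in> ?M" using a b mvars_add_le[of a X b] keys_add[of a b] by blast
  next
    fix a b :: "('v, 'k) mpol" assume a: "a \<in> ?M" and b: "mvars b \<subseteq> X"
    have "\<exists>e\<in>E. e \<subseteq> Poly_Mapping.keys m" if m: "m \<in> Poly_Mapping.keys (b * a)" for m
    proof -
      obtain k l where "m = k + l" "l \<in> Poly_Mapping.keys a"
        using subsetD[OF keys_mult m] by auto
      moreover from this obtain e where "e \<in> E" "e \<subseteq> Poly_Mapping.keys l" using a by blast
      ultimately show ?thesis by (auto simp: keys_add_nat)
    qed
    then show "b * a \<in> ?M" using a b mvars_mult_le[of b X a] by blast
  qed auto
  moreover have "?G \<subseteq> ?M" using E fin by (force simp: prod_mvar)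
  ultimately have sub: "edge_ideal X E \<subseteq> ?M"
    unfolding edge_ideal_def by (rule R.genideal_minimal)
  moreover have "f \<in> edge_ideal X E" if f: "f \<in> ?M"
  proof -
    have "Poly_Mapping.single m c \<in> edge_ideal X E" if m: "m \<in> Poly_Mapping.keys f" for m and c :: 'k
    proof -
      obtain e where e: "e \<in> E" "e \<subseteq> Poly_Mapping.keys m" using f m by blast
      let ?e = "squarefree_monom e"
      have me: "(m - ?e) + ?e = m"
      proof (rule poly_mapping_eqI)
        fix k
        show "Poly_Mapping.lookup ((m - ?e) + ?e) k = Poly_Mapping.lookup m k"
          using e fin[OF e(1)] by (auto simp: lookup_add lookup_minus lookup_squarefree_monom in_keys_iff Suc_le_eq)
      qed
      have "Poly_Mapping.single m c = Poly_Mapping.single (m - ?e) c * (\<Prod>x\<in>e. mvar x)"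
        using fin[OF e(1)] by (simp add: prod_mvar mult_single me)
      moreover have "mvars (Poly_Mapping.single (m - ?e) c) \<subseteq> X"
      proof -
        have "Poly_Mapping.keys (m - ?e) \<subseteq> Poly_Mapping.keys m" by (auto simp: in_keys_iff lookup_minus)
        then have "Poly_Mapping.keys (m - ?e) \<subseteq> X" using f keys_subset_mvars[OF m] by blast
        then show ?thesis by (rule order.trans[OF mvars_single])
      qed
      moreover have "(\<Prod>x\<in>e. mvar x :: ('v, 'k) mpol) \<in> edge_ideal X E"
        unfolding edge_ideal_def by (intro subsetD[OF R.genideal_self[OF G]] imageI e(1))
      ultimately show ?thesis using mpoly_ideal_mult[OF id] by simp
    qed
    then have "(\<Sum>m\<in>Poly_Mapping.keys f. Poly_Mapping.single m (Poly_Mapping.lookup f m)) \<in> edge_ideal X E"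
      by (intro mpoly_ideal_sum[OF id])
    then show ?thesis by (simp add: mpol_expand)
  qed
  ultimately show ?thesis by blast
qed

lemma ideal_edge_ideal:
  assumes "E \<subseteq> Pow X" "\<And>e. e \<in> E \<Longrightarrow> finite e"
  shows "ideal (edge_ideal X E :: ('v, 'k::comm_ring_1) mpol set) (mpoly_ring X)"
proof -
  interpret R: cring "mpoly_ring X :: ('v, 'k) mpol ring" by (rule cring_mpoly_ring)
  show ?thesis unfolding edge_ideal_def
    using assms by (intro R.genideal_ideal) (auto simp: prod_mvar)
qed

lemma prod_mvar_in_edge_ideal_iff:
  assumes "E \<subseteq> Pow X" "\<And>e. e \<in> E \<Longrightarrow> finite e" "finite A" "A \<subseteq> X"
  shows "(\<Prod>x\<in>A. mvar x) \<in> (edge_ideal X E :: ('v, 'k::comm_ring_1) mpol set) \<longleftrightarrow> (\<exists>e\<in>E. e \<subseteq> A)"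
  using assms by (simp add: mem_edge_ideal_iff prod_mvar)

text \<open>An edge of one clutter contains an edge of the other, which in turn contains an edge of
  the first; the antichain condition makes all three equal. This gives uniqueness in the definite
  description of the jet clutter.\<close>

lemma clutter_edge_ideal_inj:
  assumes X: "finite X" and E: "clutter X E" "clutter X E'"
    and eq: "(edge_ideal X E :: ('v, 'k::comm_ring_1) mpol set) = edge_ideal X E'"
  shows "E = E'"
proof -
  have fin: "finite e" if "e \<in> E \<or> e \<in> E'" for e
  proof -
    have "e \<subseteq> X" using that E by (auto simp: clutter_def)
    then show ?thesis using X by (rule finite_subset)
  qed
  have EX: "E \<subseteq> Pow X" "E' \<subseteq> Pow X" using E by (auto simp: clutter_def)
  have same: "(\<exists>e\<in>E. e \<subseteq> A) \<longleftrightarrow> (\<exists>e\<in>E'. e \<subseteq> A)" if "A \<subseteq> X" for A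
    using prod_mvar_in_edge_ideal_iff[where 'k = 'k, OF EX(1) _ finite_subset[OF that X] that]
      prod_mvar_in_edge_ideal_iff[where 'k = 'k, OF EX(2) _ finite_subset[OF that X] that] fin eq by blast
  have "F \<subseteq> F'" if F: "clutter X F" and sameF: "\<And>A. A \<subseteq> X \<Longrightarrow> (\<exists>e\<in>F. e \<subseteq> A) \<longleftrightarrow> (\<exists>e\<in>F'. e \<subseteq> A)" and F': "F' \<subseteq> Pow X" for F F'
  proof
    fix A assume A: "A \<in> F"
    then have "A \<subseteq> X" using F by (auto simp: clutter_def)
    then obtain B where B: "B \<in> F'" "B \<subseteq> A" using sameF A by blast
    moreover from B have "B \<subseteq> X" using F' by blast
    then obtain C where C: "C \<in> F" "C \<subseteq> B" using sameF B by blast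
    ultimately have "C = A" using F A by (auto simp: clutter_def)
    then have "A = B" using B C by blast
    then show "A \<in> F'" using B by simp
  qed
  then show ?thesis using E EX same by (metis subset_antisym)
qed

section \<open>Ideals generated by variables, as edge ideals of singletons\<close>

lemma var_ideal_eq_edge_ideal: "var_ideal X Y = edge_ideal X ((\<lambda>y. {y}) ` Y)"
  by (simp add: var_ideal_def edge_ideal_def image_image)

lemma mem_var_ideal_iff:
  fixes f :: "('v, 'k::comm_ring_1) mpol"
  assumes "Y \<subseteq> X"
  shows "f \<in> var_ideal X Y \<longleftrightarrow>
    mvars f \<subseteq> X \<and> (\<forall>m\<in>Poly_Mapping.keys f. Poly_Mapping.keys m \<inter> Y \<noteq> {})"
proof -
  have "f \<in> var_ideal X Y \<longleftrightarrow>
    mvars f \<subseteq> X \<and> (\<forall>m\<in>Poly_Mapping.keys f. \<exists>e\<in>(\<lambda>y. {y}) ` Y. e \<subseteq> Poly_Mapping.keys m)"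
    unfolding var_ideal_eq_edge_ideal by (rule mem_edge_ideal_iff) (use assms in auto)
  then show ?thesis by auto
qed

lemma mvar_in_var_ideal_iff:
  assumes "Y \<subseteq> X" "x \<in> X"
  shows "mvar x \<in> (var_ideal X Y :: ('v, 'k::comm_ring_1) mpol set) \<longleftrightarrow> x \<in> Y"
  using assms by (simp add: mem_var_ideal_iff) (simp add: mvar_def)

lemma edge_ideal_subset_var_ideal:
  assumes "E \<subseteq> Pow X" "\<And>e. e \<in> E \<Longrightarrow> finite e" "vertex_cover X E W"
  shows "edge_ideal X E \<subseteq> (var_ideal X W :: ('v, 'k::comm_ring_1) mpol set)"
proof
  fix f :: "('v, 'k) mpol" assume f: "f \<in> edge_ideal X E"
  have W: "W \<subseteq> X" "\<And>e. e \<in> E \<Longrightarrow> W \<inter> e \<noteq> {}" using assms(3) by (auto simp: vertex_cover_def)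
  show "f \<in> var_ideal X W"
    using f mem_edge_ideal_iff[OF assms(1,2), of f] unfolding mem_var_ideal_iff[OF W(1)]
    using W(2) by blast
qed

text \<open>
  For two polynomials outside the ideal, the largest monomials without variables from \<open>Y\<close>
  multiply to a monomial that cannot be cancelled in the product.
\<close>

lemma primeideal_var_ideal:
  assumes "finite X" "Y \<subseteq> X"
  shows "primeideal (var_ideal X Y) (mpoly_ring X :: ('v, 'k::idom) mpol ring)"
proof (rule primeidealI)
  show "ideal (var_ideal X Y) (mpoly_ring X :: ('v, 'k) mpol ring)"
    unfolding var_ideal_eq_edge_ideal using assms by (intro ideal_edge_ideal) auto
  show "cring (mpoly_ring X :: ('v, 'k) mpol ring)" by (rule cring_mpoly_ring)
  have "(1 :: ('v, 'k) mpol) \<notin> var_ideal X Y" by (simp add: mem_var_ideal_iff[OF assms(2)])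
  then show "carrier (mpoly_ring X :: ('v, 'k) mpol ring) \<noteq> var_ideal X Y"
    by (metis mpoly_ring_simps(1) mvars_simps(2) empty_subsetI)
  obtain w :: "('v \<Rightarrow>\<^sub>0 nat) \<Rightarrow> (nat \<Rightarrow>\<^sub>0 nat)" where "monomial_order X w"
    using monomial_order_exists[OF assms(1)] .
  then interpret monomial_order X w .
  fix f g :: "('v, 'k) mpol"
  assume f: "f \<in> carrier (mpoly_ring X)" and g: "g \<in> carrier (mpoly_ring X)"
    and fg: "f \<otimes>\<^bsub>mpoly_ring X\<^esub> g \<in> var_ideal X Y"
  show "f \<in> var_ideal X Y \<or> g \<in> var_ideal X Y"
  proof (rule ccontr)
    assume no: "\<not> ?thesis"
    define K where "K h = {m \<in> Poly_Mapping.keys h. Poly_Mapping.keys m \<inter> Y = {}}" for h :: "('v, 'k) mpol"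
    have fin: "finite (K h)" for h unfolding K_def by simp
    have "K f \<noteq> {}" "K g \<noteq> {}"
      using no f g unfolding mem_var_ideal_iff[OF assms(2)] K_def by auto
    obtain m where m: "m \<in> K f" and m_max: "\<And>a. a \<in> K f \<Longrightarrow> w a \<le> w m"
      using ex_max_monomial[OF fin \<open>K f \<noteq> {}\<close>] by metis
    obtain n where n: "n \<in> K g" and n_max: "\<And>a. a \<in> K g \<Longrightarrow> w a \<le> w n"
      using ex_max_monomial[OF fin \<open>K g \<noteq> {}\<close>] by metis
    have keysX: "Poly_Mapping.keys a \<subseteq> X" if "a \<in> Poly_Mapping.keys f \<union> Poly_Mapping.keys g" for a
      using that f g keys_subset_mvars by fastforce
    have disj: "Poly_Mapping.keys (m + n) \<inter> Y = {}"
      using m n by (auto simp: keys_add_nat K_def)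
    have "Poly_Mapping.lookup (f * g) (m + n) = Poly_Mapping.lookup f m * Poly_Mapping.lookup g n"
    proof (rule lookup_mult_unique)
      fix a b assume a: "a \<in> Poly_Mapping.keys f" and b: "b \<in> Poly_Mapping.keys g" and ab: "a + b = m + n"
      \<comment> \<open>A factor of a monomial without variables from \<open>Y\<close> has none
        either, so \<open>a\<close> and \<open>b\<close> are bounded by the maxima \<open>m\<close>
        and \<open>n\<close>. Equality of the sums then forces equality of both ranks.\<close>
      have "a \<in> K f" "b \<in> K g"
        using a b disj unfolding ab[symmetric] keys_add_nat by (auto simp: K_def)
      then have le: "w a \<le> w m" "w b \<le> w n" using m_max n_max by auto
      have "w a + w b = w m + w n" using ab w_add by metis
      then have "w a = w m" "w b = w n"
        using le add_mono add_less_le_mono add_le_less_mono by (metis order.strict_iff_order)+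
      then show "a = m \<and> b = n"
        using w_eqD keysX a b m n by (auto simp: K_def)
    qed
    also have "\<dots> \<noteq> 0" using m n by (auto simp: K_def in_keys_iff)
    finally have "m + n \<in> Poly_Mapping.keys (f * g)" by (simp add: in_keys_iff)
    then show False using fg disj unfolding mem_var_ideal_iff[OF assms(2)] by auto
  qed
qed

lemma mpoly_ring_pow [simp]: "a [^]\<^bsub>mpoly_ring X\<^esub> (n::nat) = a ^ n"
proof -
  interpret R: cring "mpoly_ring X :: ('a, 'b) mpol ring" by (rule cring_mpoly_ring)
  show ?thesis by (induction n) (simp_all add: mult.commute)
qed

text \<open>If the support of a term of \<open>a\<close> contained no edge, its complement would be
  a vertex cover. The prime generated by that cover contains a power of \<open>a\<close>, hence
  \<open>a\<close>, but it cannot contain this term.\<close>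

lemma radical_edge_ideal:
  assumes X: "finite X" and E: "E \<subseteq> Pow X"
    and a: "a \<in> carrier (mpoly_ring X)"
    and an: "a ^ n \<in> (edge_ideal X E :: ('v, 'k::idom) mpol set)"
  shows "a \<in> edge_ideal X E"
proof -
  let ?R = "mpoly_ring X :: ('v, 'k) mpol ring"
  have fin: "finite e" if "e \<in> E" for e using that X E by (auto intro: finite_subset)
  have "\<exists>e\<in>E. e \<subseteq> Poly_Mapping.keys m" if m: "m \<in> Poly_Mapping.keys a" for m
  proof (rule ccontr)
    assume "\<not> ?thesis"
    then have "vertex_cover X E (X - Poly_Mapping.keys m)"
      using E by (auto simp: vertex_cover_def)
    then have *: "a ^ n \<in> var_ideal X (X - Poly_Mapping.keys m)"
      using an edge_ideal_subset_var_ideal[OF E fin] by blast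
    interpret P: primeideal "var_ideal X (X - Poly_Mapping.keys m)" ?R
      using X by (intro primeideal_var_ideal) auto
    have "a \<in> var_ideal X (X - Poly_Mapping.keys m)"
      using P.power_memD[OF a, of n] * by simp
    then show False using m by (subst (asm) mem_var_ideal_iff) auto
  qed
  then show ?thesis using a by (simp add: mem_edge_ideal_iff[OF E fin])
qed

section \<open>Jets of squarefree monomial ideals\<close>

text \<open>The generators in the theorem of Goward and Smith, as vertex sets: \<open>i\<close>
  assigns to each vertex of the edge the index of its jet variable.\<close>

definition jet_edges :: "nat \<Rightarrow> 'v set set \<Rightarrow> ('v \<times> nat) set set" where
  "jet_edges s E = {(\<lambda>x. (x, i x)) ` e | e i. e \<in> E \<and> (\<Sum>x\<in>e. i x) \<le> s}"

lemma jet_edges_subset: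
  assumes "E \<subseteq> Pow X" "\<And>e. e \<in> E \<Longrightarrow> finite e"
  shows "jet_edges s E \<subseteq> Pow (jet_vars s X)"
proof
  fix A assume "A \<in> jet_edges s E"
  then obtain e i where A: "A = (\<lambda>x. (x, i x)) ` e" "e \<in> E" "(\<Sum>x\<in>e. i x) \<le> s"
    by (auto simp: jet_edges_def)
  have "i x \<le> s" if "x \<in> e" for x
    using member_le_sum[OF that, of i] A assms(2)[OF A(2)] by simp
  then show "A \<in> Pow (jet_vars s X)" using A assms(1) by (auto simp: jet_vars_def)
qed

lemma finite_jet_edge:
  "(\<And>e. e \<in> E \<Longrightarrow> finite e) \<Longrightarrow> A \<in> jet_edges s E \<Longrightarrow> finite A"
  by (auto simp: jet_edges_def)

text \<open>Inclusion projects to the underlying edges, which therefore coincide. Each vertex has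
  only one index in a jet edge, so the indices agree too.\<close>

lemma clutter_jet_edges:
  assumes "clutter X E" "\<And>e. e \<in> E \<Longrightarrow> finite e"
  shows "clutter (jet_vars s X) (jet_edges s E)"
  unfolding clutter_def
proof (intro conjI ballI impI)
  show "jet_edges s E \<subseteq> Pow (jet_vars s X)"
    using assms by (intro jet_edges_subset) (auto simp: clutter_def)
  fix A B assume "A \<in> jet_edges s E" "B \<in> jet_edges s E" and sub: "A \<subseteq> B"
  then obtain e i e' i' where A: "A = (\<lambda>x. (x, i x)) ` e" "e \<in> E"
    and B: "B = (\<lambda>x. (x, i' x)) ` e'" "e' \<in> E"
    by (auto simp: jet_edges_def)
  have "e \<subseteq> e'" using sub unfolding A B by blast
  then have "e = e'" using assms(1) A B by (simp add: clutter_def)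
  moreover have "i x = i' x" if "x \<in> e" for x using sub that unfolding A B by blast
  ultimately show "A = B" unfolding A B by simp
qed

section \<open>Coefficients of the jets of an edge\<close>

lemma jet_subst_prod: "jet_subst s (\<Prod>x\<in>A. f x) = (\<Prod>x\<in>A. jet_subst s (f x))"
  by (induction A rule: infinite_finite_induct) (simp_all add: jet_subst_one jet_subst_mult)

lemma coeff_jet_subst_var: "coeff (jet_subst s (mvar x)) j = (if j \<le> s then mvar (x, j) else 0)"
  by (simp add: jet_subst_var coeff_sum)

lemma coeff_0_prod: "coeff (\<Prod>x\<in>A. p x) 0 = (\<Prod>x\<in>A. coeff (p x) 0)"
  by (induction A rule: infinite_finite_induct) (simp_all add: coeff_mult_0)

lemma in_keys_sumD:
  "m \<in> Poly_Mapping.keys (\<Sum>a\<in>A. h a) \<Longrightarrow> \<exists>a\<in>A. m \<in> Poly_Mapping.keys (h a)"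
  by (rule ccontr) (simp add: in_keys_iff lookup_sum)

text \<open>Expanding the product takes one term \<open>x_j t^j\<close> from every factor, and the
  exponents of \<open>t\<close> add up to \<open>k\<close>.\<close>

lemma keys_coeff_jet_prod:
  assumes "finite e"
    and "m \<in> Poly_Mapping.keys (coeff (\<Prod>x\<in>e. jet_subst s (mvar x :: ('v, 'k::comm_ring_1) mpol)) k)"
  shows "\<exists>i. (\<Sum>x\<in>e. i x) = k \<and> (\<lambda>x. (x, i x)) ` e \<subseteq> Poly_Mapping.keys m"
  using assms
proof (induction e arbitrary: m k)
  case empty
  then show ?case by (cases "k = 0") (simp_all add: coeff_1)
next
  case (insert y e)
  let ?p = "\<Prod>x\<in>e. jet_subst s (mvar x :: ('v, 'k) mpol)"
  let ?q = "jet_subst s (mvar y :: ('v, 'k) mpol)"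
  have "m \<in> Poly_Mapping.keys (\<Sum>j\<le>k. coeff ?q j * coeff ?p (k - j))"
    using insert by (simp add: coeff_mult)
  then obtain j where j: "j \<le> k" "m \<in> Poly_Mapping.keys (coeff ?q j * coeff ?p (k - j))"
    by (auto dest: in_keys_sumD)
  obtain a b where ab: "m = a + b" "a \<in> Poly_Mapping.keys (coeff ?q j)"
    "b \<in> Poly_Mapping.keys (coeff ?p (k - j))"
    using subsetD[OF keys_mult j(2)] by auto
  have a: "a = Poly_Mapping.single (y, j) 1"
    using ab(2) unfolding coeff_jet_subst_var by (auto simp: mvar_def split: if_splits)
  obtain i where i: "(\<Sum>x\<in>e. i x) = k - j" "(\<lambda>x. (x, i x)) ` e \<subseteq> Poly_Mapping.keys b"
    using insert.IH[OF ab(3)] by blast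
  let ?i = "i(y := j)"
  have "(\<Sum>x\<in>e. ?i x) = (\<Sum>x\<in>e. i x)" using insert.hyps by (intro sum.cong) auto
  then have "(\<Sum>x\<in>insert y e. ?i x) = k" using insert.hyps i(1) j(1) by simp
  moreover have "(\<lambda>x. (x, ?i x)) ` insert y e \<subseteq> Poly_Mapping.keys m"
    using i(2) insert.hyps by (auto simp: ab(1) keys_add_nat a split: if_splits)
  ultimately show ?case by blast
qed

text \<open>Evaluates the definite description of the jet ideal on the edge monomials; they form a
  finite generating set because \<open>X\<close> is finite.\<close>

lemma jet_ideal_edge_ideal:
  assumes "finite X" "E \<subseteq> Pow X"
  shows "jet_ideal X s (edge_ideal X E :: ('v, 'k::comm_ring_1) mpol set) =
    Idl\<^bsub>mpoly_ring (jet_vars s X)\<^esub> (jet_gens s ((\<lambda>e. \<Prod>x\<in>e. mvar x) ` E))"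
  unfolding edge_ideal_def
proof (rule jet_ideal_genideal)
  show "finite ((\<lambda>e. \<Prod>x\<in>e. mvar x :: ('v, 'k) mpol) ` E)"
    using assms by (metis finite_Pow_iff finite_imageI finite_subset)
  have "mvars (\<Prod>x\<in>e. mvar x :: ('v, 'k) mpol) \<subseteq> X" if "e \<in> E" for e
  proof -
    have "e \<subseteq> X" using that assms(2) by blast
    then show ?thesis using finite_subset[OF _ assms(1)] by (simp add: prod_mvar)
  qed
  then show "(\<lambda>e. \<Prod>x\<in>e. mvar x :: ('v, 'k) mpol) ` E \<subseteq> carrier (mpoly_ring X)" by auto
qed

lemma jet_gens_edges_carrier:
  assumes "finite X" "E \<subseteq> Pow X"
  shows "jet_gens s ((\<lambda>e. \<Prod>x\<in>e. mvar x :: ('v, 'k::comm_ring_1) mpol) ` E)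
    \<subseteq> carrier (mpoly_ring (jet_vars s X))"
proof -
  have "mvars (coeff (jet_subst s (\<Prod>x\<in>e. mvar x :: ('v, 'k) mpol)) j) \<subseteq> jet_vars s X" if "e \<in> E" for e j
  proof (rule mvars_coeff_jet_subst)
    have "e \<subseteq> X" using that assms(2) by blast
    then show "mvars (\<Prod>x\<in>e. mvar x :: ('v, 'k) mpol) \<subseteq> X"
      using finite_subset[OF _ assms(1)] by (simp add: prod_mvar)
  qed
  then show ?thesis by (auto simp: jet_gens_def)
qed

lemma ideal_jet_ideal:
  assumes "finite X" "E \<subseteq> Pow X"
  shows "ideal (jet_ideal X s (edge_ideal X E :: ('v, 'k::comm_ring_1) mpol set)) (mpoly_ring (jet_vars s X))"
proof -
  interpret R: cring "mpoly_ring (jet_vars s X) :: ('v \<times> nat, 'k) mpol ring" by (rule cring_mpoly_ring)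
  show ?thesis unfolding jet_ideal_edge_ideal[OF assms]
    by (rule R.genideal_ideal[OF jet_gens_edges_carrier[OF assms]])
qed

lemma jet_coeff_in_jet_ideal:
  assumes "finite X" "E \<subseteq> Pow X" "e \<in> E" "j \<le> s"
  shows "coeff (\<Prod>x\<in>e. jet_subst s (mvar x)) j
    \<in> jet_ideal X s (edge_ideal X E :: ('v, 'k::comm_ring_1) mpol set)"
proof -
  interpret R: cring "mpoly_ring (jet_vars s X) :: ('v \<times> nat, 'k) mpol ring" by (rule cring_mpoly_ring)
  have "coeff (jet_subst s (\<Prod>x\<in>e. mvar x :: ('v, 'k) mpol)) j \<in> jet_gens s ((\<lambda>e. \<Prod>x\<in>e. mvar x) ` E)"
    unfolding jet_gens_def using assms(3,4) by blast
  then show ?thesis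
    unfolding jet_ideal_edge_ideal[OF assms(1,2)] jet_subst_prod[symmetric]
    using R.genideal_self[OF jet_gens_edges_carrier[OF assms(1,2)]] by (rule rev_subsetD)
qed

text \<open>The easy half of the theorem of Goward and Smith: every term of a generating coefficient
  is divisible by a jet edge of total index \<open>j \<le> s\<close>.\<close>

lemma jet_ideal_subset_edge_ideal:
  assumes "finite X" "E \<subseteq> Pow X"
  shows "jet_ideal X s (edge_ideal X E) \<subseteq>
    (edge_ideal (jet_vars s X) (jet_edges s E) :: ('v \<times> nat, 'k::comm_ring_1) mpol set)"
  unfolding jet_ideal_edge_ideal[OF assms]
proof -
  interpret R: cring "mpoly_ring (jet_vars s X) :: ('v \<times> nat, 'k) mpol ring" by (rule cring_mpoly_ring)
  have fin: "finite e" if "e \<in> E" for e using that assms finite_subset by blast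
  note jE = jet_edges_subset[OF assms(2) fin, of s] finite_jet_edge[OF fin]
  show "Idl\<^bsub>mpoly_ring (jet_vars s X)\<^esub> (jet_gens s ((\<lambda>e. \<Prod>x\<in>e. mvar x) ` E)) \<subseteq>
      (edge_ideal (jet_vars s X) (jet_edges s E) :: ('v \<times> nat, 'k) mpol set)"
  proof (rule R.genideal_minimal)
    show "ideal (edge_ideal (jet_vars s X) (jet_edges s E)) (mpoly_ring (jet_vars s X) :: ('v \<times> nat, 'k) mpol ring)"
      using jE by (rule ideal_edge_ideal)
    show "jet_gens s ((\<lambda>e. \<Prod>x\<in>e. mvar x) ` E) \<subseteq>
        (edge_ideal (jet_vars s X) (jet_edges s E) :: ('v \<times> nat, 'k) mpol set)"
    proof
      fix f :: "('v \<times> nat, 'k) mpol" assume f: "f \<in> jet_gens s ((\<lambda>e. \<Prod>x\<in>e. mvar x) ` E)"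
      then obtain e j where e: "e \<in> E" "j \<le> s" "f = coeff (\<Prod>x\<in>e. jet_subst s (mvar x)) j"
        by (auto simp: jet_gens_def jet_subst_prod)
      have "mvars f \<subseteq> jet_vars s X" using subsetD[OF jet_gens_edges_carrier[OF assms] f] by simp
      moreover have "\<exists>A\<in>jet_edges s E. A \<subseteq> Poly_Mapping.keys m" if "m \<in> Poly_Mapping.keys f" for m
      proof -
        have "\<exists>i. (\<Sum>x\<in>e. i x) = j \<and> (\<lambda>x. (x, i x)) ` e \<subseteq> Poly_Mapping.keys m"
          using that unfolding e(3) by (rule keys_coeff_jet_prod[OF fin[OF e(1)]])
        then show ?thesis using e by (auto simp: jet_edges_def)
      qed
      ultimately show "f \<in> edge_ideal (jet_vars s X) (jet_edges s E)"
        by (simp add: mem_edge_ideal_iff[OF jE])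
    qed
  qed
qed

text \<open>Orders in \<open>t\<close> add up over the domain modulo \<open>Q\<close>: in degree
  \<open>a + b\<close> all summands but the product of the two lowest coefficients vanish modulo
  \<open>Q\<close>.\<close>

lemma coeff_mult_first_notin_prime:
  fixes p q :: "('v, 'k::comm_ring_1) mpol poly"
  assumes Q: "primeideal Q (mpoly_ring Y)"
    and p: "\<And>j. mvars (coeff p j) \<subseteq> Y" "\<And>j. j < a \<Longrightarrow> coeff p j \<in> Q" "coeff p a \<notin> Q"
    and q: "\<And>j. mvars (coeff q j) \<subseteq> Y" "\<And>j. j < b \<Longrightarrow> coeff q j \<in> Q" "coeff q b \<notin> Q"
  shows "j < a + b \<Longrightarrow> coeff (p * q) j \<in> Q" "coeff (p * q) (a + b) \<notin> Q"
proof -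
  interpret Q: primeideal Q "mpoly_ring Y" by fact
  note Qi = mpoly_ideal[OF Q.is_ideal]
  have mem: "coeff p i * coeff q l \<in> Q" if "i < a \<or> l < b" for i l
    using that Qi(3)[OF p(2) q(1)] Qi(3)[OF q(2) p(1)] by (auto simp: mult.commute)
  show "coeff (p * q) j \<in> Q" if "j < a + b" for j
    unfolding coeff_mult by (rule Qi(6)) (use that in \<open>auto intro: mem\<close>)
  have "coeff (p * q) (a + b) = coeff p a * coeff q b + (\<Sum>i\<in>{..a + b} - {a}. coeff p i * coeff q (a + b - i))"
    unfolding coeff_mult by (subst sum.remove[of _ a]) auto
  moreover have rest: "(\<Sum>i\<in>{..a + b} - {a}. coeff p i * coeff q (a + b - i)) \<in> Q"
    by (rule Qi(6), rule mem) auto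
  moreover have "coeff p a * coeff q b \<notin> Q"
    using Q.I_prime[of "coeff p a" "coeff q b"] p q by auto
  ultimately show "coeff (p * q) (a + b) \<notin> Q"
    using Qi(4)[OF _ rest, of "coeff (p * q) (a + b)"] by auto
qed

text \<open>The last conjunct supports the induction, whose step needs the coefficients of the
  partial product in the carrier.\<close>

lemma coeff_prod_first_notin_prime:
  fixes p :: "'a \<Rightarrow> ('v, 'k::comm_ring_1) mpol poly"
  assumes "finite A" and Q: "primeideal Q (mpoly_ring Y)"
    and p: "\<And>x j. x \<in> A \<Longrightarrow> mvars (coeff (p x) j) \<subseteq> Y"
      "\<And>x j. x \<in> A \<Longrightarrow> j < d x \<Longrightarrow> coeff (p x) j \<in> Q" "\<And>x. x \<in> A \<Longrightarrow> coeff (p x) (d x) \<notin> Q"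
  shows "(\<forall>j<sum d A. coeff (\<Prod>x\<in>A. p x) j \<in> Q) \<and> coeff (\<Prod>x\<in>A. p x) (sum d A) \<notin> Q \<and>
    (\<forall>j. mvars (coeff (\<Prod>x\<in>A. p x) j) \<subseteq> Y)"
  using assms(1) p
proof (induction A)
  case empty
  interpret Q: primeideal Q "mpoly_ring Y" by (rule Q)
  have "1 \<notin> Q" using Q.I_notcarr Q.one_imp_carrier by auto
  then show ?case by (auto simp: coeff_1)
next
  case (insert y A)
  then have "(\<forall>j<sum d A. coeff (\<Prod>x\<in>A. p x) j \<in> Q) \<and> coeff (\<Prod>x\<in>A. p x) (sum d A) \<notin> Q \<and>
    (\<forall>j. mvars (coeff (\<Prod>x\<in>A. p x) j) \<subseteq> Y)" by blast
  then show ?case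
    using insert.prems insert.hyps coeff_mult_first_notin_prime[OF Q, of "p y" "d y" "\<Prod>x\<in>A. p x" "sum d A"]
      coeff_in_carrier_mult[of "p y" Y "\<Prod>x\<in>A. p x"] by simp
qed

text \<open>
  Modulo a prime containing the jets of an edge, the truncated power series of its vertices
  multiply to \<open>0\<close>, so their orders add up to more than \<open>s\<close>.
\<close>

lemma jet_edge_monomial_in_prime:
  assumes X: "finite X" "E \<subseteq> Pow X" and A: "A \<in> jet_edges s E"
    and Q: "primeideal Q (mpoly_ring (jet_vars s X) :: ('v \<times> nat, 'k::comm_ring_1) mpol ring)"
    and JQ: "jet_ideal X s (edge_ideal X E) \<subseteq> Q"
  shows "(\<Prod>v\<in>A. mvar v) \<in> Q"
proof (rule ccontr)
  assume notin: "(\<Prod>v\<in>A. mvar v) \<notin> Q"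
  interpret Q: primeideal Q "mpoly_ring (jet_vars s X) :: ('v \<times> nat, 'k) mpol ring" by fact
  have fin: "finite e" if "e \<in> E" for e using that X finite_subset by blast
  obtain e i where e: "A = (\<lambda>x. (x, i x)) ` e" "e \<in> E" "(\<Sum>x\<in>e. i x) \<le> s"
    using A by (auto simp: jet_edges_def)
  have eX: "e \<subseteq> X" using e(2) X(2) by blast
  have AX: "A \<subseteq> jet_vars s X" "finite A"
    using A jet_edges_subset[OF X(2) fin] finite_jet_edge[OF fin A] by blast+
  have not: "mvar (x, i x) \<notin> Q" if x: "x \<in> e" for x
  proof
    assume "mvar (x, i x) \<in> Q"
    moreover have "(x, i x) \<in> A" using e(1) x by blast
    then have "(\<Prod>v\<in>A. mvar v) = (\<Prod>v\<in>A - {(x, i x)}. mvar v) * (mvar (x, i x) :: ('v \<times> nat, 'k) mpol)"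
      using AX(2) by (simp add: prod.remove mult.commute)
    moreover have "mvars (\<Prod>v\<in>A - {(x, i x)}. mvar v :: ('v \<times> nat, 'k) mpol) \<subseteq> jet_vars s X"
      using AX by (auto simp: prod_mvar)
    ultimately show False using notin mpoly_ideal_mult[OF Q.is_ideal] by metis
  qed
  \<comment> \<open>The order in \<open>t\<close> of the series of \<open>x\<close> modulo
    \<open>Q\<close>. It is at most \<open>i x\<close>, because no variable of a monomial outside
    \<open>Q\<close> lies in \<open>Q\<close>.\<close>
  define d where "d x = (LEAST j. mvar (x, j) \<notin> Q)" for x
  have d: "mvar (x, d x) \<notin> Q" "d x \<le> i x" "\<And>j. j < d x \<Longrightarrow> mvar (x, j) \<in> Q" if "x \<in> e" for x
    unfolding d_def
    using LeastI[of "\<lambda>j. mvar (x, j) \<notin> Q", OF not[OF that]]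
      Least_le[of "\<lambda>j. mvar (x, j) \<notin> Q", OF not[OF that]] not_less_Least[of _ "\<lambda>j. mvar (x, j) \<notin> Q"]
    by blast+
  have le: "d x \<le> s" if "x \<in> e" for x
    using d(2)[OF that] member_le_sum[OF that, of i] e(3) fin[OF e(2)] by simp
  \<comment> \<open>Hence the coefficient in degree \<open>sum d e\<close> is one of the generators
    of the jet ideal, although additivity of orders keeps it outside \<open>Q\<close>.\<close>
  have "sum d e \<le> s" using sum_mono[of e d i] d(2) e(3) by simp
  then have "coeff (\<Prod>x\<in>e. jet_subst s (mvar x)) (sum d e) \<in> Q"
    using jet_coeff_in_jet_ideal[OF X e(2)] JQ by blast
  moreover have "coeff (\<Prod>x\<in>e. jet_subst s (mvar x)) (sum d e) \<notin> Q"
  proof (rule coeff_prod_first_notin_prime[OF fin[OF e(2)] Q, THEN conjunct2, THEN conjunct1])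
    fix x j assume x: "x \<in> e"
    show "mvars (coeff (jet_subst s (mvar x :: ('v, 'k) mpol)) j) \<subseteq> jet_vars s X"
      using x eX by (intro mvars_coeff_jet_subst) auto
    show "coeff (jet_subst s (mvar x :: ('v, 'k) mpol)) (d x) \<notin> Q"
      using d(1)[OF x] le[OF x] by (simp add: coeff_jet_subst_var)
    show "coeff (jet_subst s (mvar x :: ('v, 'k) mpol)) j \<in> Q" if "j < d x"
      using d(3)[OF x that] le[OF x] that by (simp add: coeff_jet_subst_var)
  qed
  ultimately show False by simp
qed

text \<open>The theorem of Goward and Smith. One inclusion holds because squarefree monomial ideals
  are radical; the other because a polynomial outside the radical is avoided by a prime above the
  jet ideal, and such a prime contains all jet edge monomials.\<close>

theorem radical_jet_ideal:
  assumes X: "finite X" "E \<subseteq> Pow X"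
  shows "radical (mpoly_ring (jet_vars s X)) (jet_ideal X s (edge_ideal X E)) =
    (edge_ideal (jet_vars s X) (jet_edges s E) :: ('v \<times> nat, 'k::field) mpol set)"
proof -
  let ?R = "mpoly_ring (jet_vars s X) :: ('v \<times> nat, 'k) mpol ring"
  interpret R: cring ?R by (rule cring_mpoly_ring)
  have fin: "finite e" if "e \<in> E" for e using that X finite_subset by blast
  have finX: "finite (jet_vars s X)" using X(1) by (simp add: jet_vars_def)
  note jE = jet_edges_subset[OF X(2) fin, of s] finite_jet_edge[OF fin]
  show ?thesis
  proof (intro equalityI subsetI)
    fix a :: "('v \<times> nat, 'k) mpol"
    assume "a \<in> radical ?R (jet_ideal X s (edge_ideal X E))"
    then obtain n where "a \<in> carrier ?R" "a ^ n \<in> jet_ideal X s (edge_ideal X E)"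
      by (auto simp: radical_def)
    then show "a \<in> edge_ideal (jet_vars s X) (jet_edges s E)"
      using radical_edge_ideal[OF finX jE(1)] jet_ideal_subset_edge_ideal[OF X] by blast
  next
    fix a :: "('v \<times> nat, 'k) mpol" assume a: "a \<in> edge_ideal (jet_vars s X) (jet_edges s E)"
    then have ac: "a \<in> carrier ?R" by (simp add: mem_edge_ideal_iff[OF jE])
    show "a \<in> radical ?R (jet_ideal X s (edge_ideal X E))"
    proof (rule ccontr)
      assume "\<not> ?thesis"
      then have "a [^]\<^bsub>?R\<^esub> n \<notin> jet_ideal X s (edge_ideal X E)" for n :: nat
        using ac unfolding radical_def by blast
      then obtain Q where Q: "primeideal Q ?R" "jet_ideal X s (edge_ideal X E) \<subseteq> Q" "a \<notin> Q"
        using R.prime_ideal_avoiding_powers[OF noetherian_mpoly_ring[OF finX] ideal_jet_ideal[OF X] ac]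
        by blast
      have "edge_ideal (jet_vars s X) (jet_edges s E) \<subseteq> Q"
        unfolding edge_ideal_def
      proof (rule R.genideal_minimal)
        show "ideal Q ?R" using Q(1) by (rule primeideal.axioms(1))
      qed (use jet_edge_monomial_in_prime[OF X _ Q(1,2)] in blast)
      then show False using a Q(3) by blast
    qed
  qed
qed

text \<open>Existence comes from the radical just computed, uniqueness from the fact that a clutter
  is determined by its edge ideal.\<close>

corollary jet_clutter_eq:
  assumes X: "finite X" and E: "clutter X E"
  shows "jet_clutter TYPE('k::field) X s E = jet_edges s E"
  unfolding jet_clutter_def
proof (rule the_equality)
  have EX: "E \<subseteq> Pow X" using E by (simp add: clutter_def)
  have fin: "finite e" if "e \<in> E" for e using that X EX finite_subset by blast
  note rad = radical_jet_ideal[OF X EX, where 'k = 'k and s = s]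
  show *: "clutter (jet_vars s X) (jet_edges s E) \<and>
      (edge_ideal (jet_vars s X) (jet_edges s E) :: ('a \<times> nat, 'k) mpol set) =
        radical (mpoly_ring (jet_vars s X)) (jet_ideal X s (edge_ideal X E))"
    using clutter_jet_edges[OF E fin] rad by simp
  fix E' assume "clutter (jet_vars s X) E' \<and>
      (edge_ideal (jet_vars s X) E' :: ('a \<times> nat, 'k) mpol set) =
        radical (mpoly_ring (jet_vars s X)) (jet_ideal X s (edge_ideal X E))"
  then show "E' = jet_edges s E"
    using * X by (intro clutter_edge_ideal_inj[where 'k = 'k, of "jet_vars s X"]) (auto simp: jet_vars_def)
qed

section \<open>The component of a minimal vertex cover\<close>

text \<open>Removing \<open>x\<close> must leave some edge uncovered, and \<open>x\<close> is then
  the only vertex of the cover on that edge.\<close>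

lemma minimal_vertex_cover_private_edge:
  assumes "minimal_vertex_cover X E W" "x \<in> W"
  obtains e where "e \<in> E" "W \<inter> e = {x}"
proof -
  have W: "vertex_cover X E W" and "\<not> vertex_cover X E (W - {x})"
    using assms by (auto simp: minimal_vertex_cover_def)
  then obtain e where "e \<in> E" "(W - {x}) \<inter> e = {}" by (auto simp: vertex_cover_def)
  moreover have "W \<inter> e \<noteq> {}" using W \<open>e \<in> E\<close> by (auto simp: vertex_cover_def)
  ultimately have "W \<inter> e = {x}" by blast
  then show ?thesis using that \<open>e \<in> E\<close> by blast
qed

lemma vertex_cover_jet_vars:
  assumes "vertex_cover X E W" "\<And>e. e \<in> E \<Longrightarrow> finite e"
  shows "vertex_cover (jet_vars s X) (jet_edges s E) (jet_vars s W)"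
  unfolding vertex_cover_def
proof (intro conjI ballI)
  show "jet_vars s W \<subseteq> jet_vars s X" using assms(1) by (auto simp: vertex_cover_def jet_vars_def)
  fix A assume "A \<in> jet_edges s E"
  then obtain e i where A: "A = (\<lambda>x. (x, i x)) ` e" "e \<in> E" "(\<Sum>x\<in>e. i x) \<le> s"
    by (auto simp: jet_edges_def)
  obtain x where x: "x \<in> W" "x \<in> e" using assms(1) A(2) by (auto simp: vertex_cover_def)
  have "i x \<le> s" using member_le_sum[OF x(2), of i] A assms(2)[OF A(2)] by simp
  then have "(x, i x) \<in> jet_vars s W \<inter> A" using x A(1) by (auto simp: jet_vars_def)
  then show "jet_vars s W \<inter> A \<noteq> {}" by blast
qed

text \<open>
  The \<open>j\<close>-th coefficient of the jet of the edge is \<open>c x\<^sub>j\<close> plus a combination of the \<open>x\<^sub>i\<close> with \<open>i < j\<close>,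
  where \<open>c\<close> is the constant coefficient of the jet of the other vertices.
\<close>

lemma jet_var_mult_power_in_jet_ideal:
  fixes X :: "'v set"
  assumes X: "finite X" "E \<subseteq> Pow X" and e: "e \<in> E" "x \<in> e" and "j \<le> s"
  shows "mvar (x, j) * (\<Prod>y\<in>e - {x}. mvar (y, 0)) ^ Suc j
    \<in> jet_ideal X s (edge_ideal X E :: ('v, 'k::comm_ring_1) mpol set)"
  using \<open>j \<le> s\<close>
proof (induction j rule: less_induct)
  case (less j)
  let ?J = "jet_ideal X s (edge_ideal X E :: ('v, 'k) mpol set)"
  note J = mpoly_ideal[OF ideal_jet_ideal[OF X, of s, where 'k = 'k]]
  have eX: "e \<subseteq> X" "finite e" using e X by (auto intro: finite_subset)
  define g where "g = (\<Prod>y\<in>e - {x}. jet_subst s (mvar y :: ('v, 'k) mpol))"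
  define c where "c = (\<Prod>y\<in>e - {x}. mvar (y, 0::nat) :: ('v \<times> nat, 'k) mpol)"
  have c: "coeff g 0 = c"
    by (simp add: g_def c_def coeff_0_prod coeff_jet_subst_var)
  have gX: "mvars (coeff g i) \<subseteq> jet_vars s X" for i
    unfolding g_def jet_subst_prod[symmetric] using eX
    by (intro mvars_coeff_jet_subst) (auto simp: prod_mvar)
  then have cX: "mvars (c ^ n) \<subseteq> jet_vars s X" for n
    unfolding c[symmetric] by (induction n) (simp_all add: mvars_mult_le)
  let ?f = "coeff (\<Prod>y\<in>e. jet_subst s (mvar y :: ('v, 'k) mpol)) j"
  have "?f = coeff (jet_subst s (mvar x) * g) j"
    using eX e(2) by (simp add: g_def prod.remove)
  also have "\<dots> = (\<Sum>i\<le>j. mvar (x, i) * coeff g (j - i))"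
    unfolding coeff_mult using less.prems by (intro sum.cong) (auto simp: coeff_jet_subst_var)
  also have "\<dots> = (\<Sum>i<j. mvar (x, i) * coeff g (j - i)) + mvar (x, j) * c"
    by (simp add: lessThan_Suc_atMost[symmetric] c)
  finally have f: "mvar (x, j) * c = ?f - (\<Sum>i<j. mvar (x, i) * coeff g (j - i))" by simp
  \<comment> \<open>One factor \<open>c\<close> isolates \<open>x_j\<close>; the other
    \<open>j\<close> factors are reserved for the lower jet variables.\<close>
  have "mvar (x, j) * c ^ Suc j = c ^ j * (mvar (x, j) * c)" by (simp add: ac_simps)
  also have "\<dots> = c ^ j * ?f - (\<Sum>i<j. c ^ j * (mvar (x, i) * coeff g (j - i)))"
    unfolding f by (simp add: right_diff_distrib sum_distrib_left)
  also have "\<dots> \<in> ?J"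
  proof (rule J(4)[OF J(3)[OF _ cX] J(6)])
    show "?f \<in> ?J" using less.prems by (rule jet_coeff_in_jet_ideal[OF X e(1)])
    fix i assume "i \<in> {..<j}"
    then have i: "i < j" by simp
    \<comment> \<open>As \<open>i < j\<close>, the power contains the \<open>Suc i\<close> factors
      that the induction hypothesis needs for \<open>x_i\<close>.\<close>
    have "c ^ j = c ^ (j - Suc i) * c ^ Suc i" using i by (subst power_add[symmetric]) simp
    then have "c ^ j * (mvar (x, i) * coeff g (j - i)) =
        (c ^ (j - Suc i) * coeff g (j - i)) * (mvar (x, i) * c ^ Suc i)"
      by (simp only: ac_simps)
    also have "\<dots> \<in> ?J"
    proof (rule J(3))
      show "mvar (x, i) * c ^ Suc i \<in> ?J" using less.IH[OF i] i less.prems by (simp only: c_def)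
      show "mvars (c ^ (j - Suc i) * coeff g (j - i)) \<subseteq> jet_vars s X" by (intro mvars_mult_le cX gX)
    qed
    finally show "c ^ j * (mvar (x, i) * coeff g (j - i)) \<in> ?J" .
  qed
  finally show ?case by (simp only: c_def)
qed

theorem theorem3p3:
  fixes X W :: "'v set" and E :: "'v set set"
  assumes "finite X" and "clutter X E" and "minimal_vertex_cover X E W"
  shows
    "(\<forall>s.
        minimal_vertex_cover (jet_vars s X) (jet_clutter TYPE('k::field) X s E) (jet_vars s W) \<and>
        minimal_prime (mpoly_ring (jet_vars s X) :: ('v \<times> nat, 'k) mpol ring)
          (jet_ideal X s (edge_ideal X E)) (var_ideal (jet_vars s X) (jet_vars s W))) \<and>
     (\<forall>s.
        primary_component (mpoly_ring (jet_vars s X) :: ('v \<times> nat, 'k) mpol ring)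
          (jet_ideal X s (edge_ideal X E)) (var_ideal (jet_vars s X) (jet_vars s W)) \<and>
        (\<forall>Q. primary_component (mpoly_ring (jet_vars s X) :: ('v \<times> nat, 'k) mpol ring)
               (jet_ideal X s (edge_ideal X E)) Q \<longrightarrow>
             radical (mpoly_ring (jet_vars s X)) Q = var_ideal (jet_vars s X) (jet_vars s W) \<longrightarrow>
             Q = var_ideal (jet_vars s X) (jet_vars s W)))"
proof -
  have EX: "E \<subseteq> Pow X" using assms(2) by (simp add: clutter_def)
  have fin: "finite e" if "e \<in> E" for e using that assms(1) EX finite_subset by blast
  have cover: "vertex_cover X E W" using assms(3) by (simp add: minimal_vertex_cover_def)
  then have WX: "W \<subseteq> X" by (simp add: vertex_cover_def)
  have "minimal_vertex_cover (jet_vars s X) (jet_clutter TYPE('k) X s E) (jet_vars s W)"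
    and "minimal_prime (mpoly_ring (jet_vars s X) :: ('v \<times> nat, 'k) mpol ring)
          (jet_ideal X s (edge_ideal X E)) (var_ideal (jet_vars s X) (jet_vars s W))"
    and "primary_component (mpoly_ring (jet_vars s X) :: ('v \<times> nat, 'k) mpol ring)
          (jet_ideal X s (edge_ideal X E)) (var_ideal (jet_vars s X) (jet_vars s W))"
    and "\<And>Q. primary_component (mpoly_ring (jet_vars s X) :: ('v \<times> nat, 'k) mpol ring)
               (jet_ideal X s (edge_ideal X E)) Q \<Longrightarrow>
             radical (mpoly_ring (jet_vars s X)) Q = var_ideal (jet_vars s X) (jet_vars s W) \<Longrightarrow>
             Q = var_ideal (jet_vars s X) (jet_vars s W)" for s
  proof -
    let ?X = "jet_vars s X" and ?W = "jet_vars s W"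
    let ?R = "mpoly_ring ?X :: ('v \<times> nat, 'k) mpol ring"
    let ?J = "jet_ideal X s (edge_ideal X E) :: ('v \<times> nat, 'k) mpol set"
    let ?P = "var_ideal ?X ?W :: ('v \<times> nat, 'k) mpol set"
    interpret R: cring ?R by (rule cring_mpoly_ring)
    have finX: "finite ?X" using assms(1) by (simp add: jet_vars_def)
    have sub: "?W \<subseteq> ?X" using WX by (auto simp: jet_vars_def)
    note jE = jet_edges_subset[OF EX fin, of s] finite_jet_edge[OF fin]
    have jet_cover: "vertex_cover ?X (jet_edges s E) ?W"
      using cover fin by (rule vertex_cover_jet_vars)
    have JM: "?J \<subseteq> edge_ideal ?X (jet_edges s E)"
      by (rule jet_ideal_subset_edge_ideal[OF assms(1) EX])
    have JP: "?J \<subseteq> ?P"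
      by (rule order.trans[OF JM edge_ideal_subset_var_ideal[OF jE jet_cover]])
    have P: "primeideal ?P ?R" by (rule primeideal_var_ideal[OF finX sub])
    interpret P: primeideal ?P ?R by (rule P)
    have gen: "?P = Idl\<^bsub>?R\<^esub> (mvar ` ?W)" by (simp add: var_ideal_def)
    have loc: "v \<in> carrier ?R \<and> (\<exists>u\<in>carrier ?R - ?P. v \<otimes>\<^bsub>?R\<^esub> u \<in> ?J)" if v: "v \<in> mvar ` ?W" for v
    proof -
      obtain x j where x: "v = mvar (x, j)" "x \<in> W" "j \<le> s" using v by (auto simp: jet_vars_def)
      obtain e where e: "e \<in> E" "W \<inter> e = {x}"
        using minimal_vertex_cover_private_edge[OF assms(3) x(2)] .
      define c where "c = (\<Prod>y\<in>e - {x}. mvar (y, 0::nat) :: ('v \<times> nat, 'k) mpol)"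
      have "c = (\<Prod>z\<in>(\<lambda>y. (y, 0)) ` (e - {x}). mvar z)"
        unfolding c_def by (subst prod.reindex) (auto simp: inj_on_def)
      then have c: "c = Poly_Mapping.single (squarefree_monom ((\<lambda>y. (y, 0)) ` (e - {x}))) 1"
        using fin[OF e(1)] by (simp add: prod_mvar)
      have cX: "c \<in> carrier ?R" using fin[OF e(1)] e(1) EX by (auto simp: c jet_vars_def)
      \<comment> \<open>The edge meets \<open>W\<close> in \<open>x\<close> only, so the single term
        of \<open>c\<close> has no variable among the jets of \<open>W\<close>.\<close>
      have "c \<notin> ?P"
        using fin[OF e(1)] e(2) unfolding mem_var_ideal_iff[OF sub] c by (auto simp: jet_vars_def)
      then have "c ^ Suc j \<in> carrier ?R - ?P"
        using P.power_memD[OF cX, of "Suc j"] R.nat_pow_closed[OF cX, of "Suc j"]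
        unfolding mpoly_ring_pow by blast
      moreover have "v \<otimes>\<^bsub>?R\<^esub> c ^ Suc j \<in> ?J"
        unfolding x(1) c_def mpoly_ring_simps using e x(3)
        by (intro jet_var_mult_power_in_jet_ideal[OF assms(1) EX]) auto
      moreover have "v \<in> carrier ?R" using x WX by (auto simp: jet_vars_def)
      ultimately show ?thesis by blast
    qed
    note main = R.minimal_prime_component_if_locally_eq[OF noetherian_mpoly_ring[OF finX]
        ideal_jet_ideal[OF assms(1) EX] P JP gen loc]
    show "minimal_prime ?R ?J ?P" by (rule main(1))
    show "primary_component ?R ?J ?P" by (rule main(2))
    show "Q = ?P" if "primary_component ?R ?J Q" "radical ?R Q = ?P" for Q
      by (rule main(3)[OF _ that])
    show "minimal_vertex_cover ?X (jet_clutter TYPE('k) X s E) ?W"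
      unfolding jet_clutter_eq[OF assms(1,2)] minimal_vertex_cover_def
    proof (intro conjI allI impI notI jet_cover)
      fix V assume V: "V \<subset> ?W" "vertex_cover ?X (jet_edges s E) V"
      then obtain v where v: "v \<in> ?W" "v \<notin> V" by blast
      have VX: "V \<subseteq> ?X" using V(1) sub by blast
      have "?J \<subseteq> var_ideal ?X V"
        by (rule order.trans[OF JM edge_ideal_subset_var_ideal[OF jE V(2)]])
      moreover have "var_ideal ?X V \<subseteq> ?P"
        using V(1) by (fastforce simp: mem_var_ideal_iff[OF sub] mem_var_ideal_iff[OF VX])
      ultimately have "var_ideal ?X V = ?P"
        using main(1) primeideal_var_ideal[OF finX VX, where 'k = 'k]
        unfolding minimal_prime_def by blast
      \<comment> \<open>Equal variable ideals contain the same variables, but \<open>v\<close>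
        belongs to only one of the two generating sets.\<close>
      then show False
        using v sub mvar_in_var_ideal_iff[OF sub, of v, where 'k = 'k]
          mvar_in_var_ideal_iff[OF VX, of v, where 'k = 'k] by blast
    qed
  qed
  then show ?thesis by blast
qed

end
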